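(* Let $k=k(n)\in\{2,\dots,n\}$, $n\ge2$, be a sequence of integers, and consider the Block Average process on $n$ sites with deterministic block size $X\equiv k$, started from a Dirac mass. Set $$t_{\rm ent}=\frac{n\log n}{k\log k},\qquad t_{\rm w}=\frac{n\sqrt{\log n}}{k\sqrt{\log k}}.$$ Then the following two conditions are equivalent: (1) $\log k/\log n\to0$ as $n\to\infty$; (2) cutoff occurs at time $t_{\rm ent}$, i.e. $t_{\rm mix}(\varepsilon)/t_{\rm ent}\to1$ as $n\to\infty$ for every $\varepsilon\in(0,1)$, and, further, for every $\beta\in\mathbb R$, $d_{\rm TV}(\lfloor t_{\rm ent}+\beta t_{\rm w}\rfloor)\to\Phi(-\beta)$ in probability as $n\to\infty$.
   Context: Let $V=\{1,\dots,n\}$ and let $\Delta$ be the set of probability vectors on $V$. For $A\subset V$ and $\eta\in\Delta$, let $\varPsi_A\eta(x)=\frac1{|A|}\sum_{y\in A}\eta(y)$ if $x\in A$ and $\varPsi_A\eta(x)=\eta(x)$ if $x\notin A$. The Block Average process with block size $k$ is $\eta_t=\varPsi_{A_t}\cdots\varPsi_{A_1}\eta_0$, where $A_1,A_2,\dots$ are independent uniformly random subsets of $V$ of cardinality $k$; here $\eta_0$ is the Dirac mass at some $x_0\in V$. Let $\pi(x)\equiv 1/n$, $\|v\|_{\rm TV}=\frac12\sum_{x\in V}|v(x)|$, $d_{\rm TV}(t)=\|\eta_t-\pi\|_{\rm TV}$ (a random variable), and $t_{\rm mix}(\varepsilon)=\inf\{t\in\mathbb N:\ \mathbb E[d_{\rm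 TV}(t)]<\varepsilon\}$. Negative times are read as $0$. $\Phi$ is the CDF of the standard Gaussian. Logarithms are natural. *)

theory Defs
  imports "HOL-Probability.Probability"
begin

definition block_avg :: "nat set \<Rightarrow> (nat \<Rightarrow> real) \<Rightarrow> nat \<Rightarrow> real" where
  "block_avg A \<eta> x = (if x \<in> A then (1 / real (card A)) * (\<Sum>y\<in>A. \<eta> y) else \<eta> x)"

definition blocks :: "nat \<Rightarrow> nat \<Rightarrow> nat set set" where
  "blocks n k = {B. B \<subseteq> {1..n} \<and> card B = k}"

text \<open>An arbitrary realisation of the random blocks. They are indexed from 1; the value at index 0
  is never used.\<close>

locale block_choices = prob_space M for M :: "'w measure" +
  fixes n k :: nat and A :: "nat \<Rightarrow> 'w \<Rightarrow> nat set"
  assumes indep: "indep_vars (\<lambda>_. count_space (blocks n k)) A {1..}"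
    and uniform: "\<And>t. 1 \<le> t \<Longrightarrow>
      distr M (count_space (blocks n k)) (A t) = uniform_count_measure (blocks n k)"

primrec block_process :: "(nat \<Rightarrow> 'w \<Rightarrow> nat set) \<Rightarrow> nat \<Rightarrow> nat \<Rightarrow> 'w \<Rightarrow> nat \<Rightarrow> real" where
  "block_process A x0 0 = (\<lambda>\<omega>. indicator {x0})"
| "block_process A x0 (Suc t) = (\<lambda>\<omega>. block_avg (A (Suc t) \<omega>) (block_process A x0 t \<omega>))"

definition tv_norm :: "nat \<Rightarrow> (nat \<Rightarrow> real) \<Rightarrow> real" where
  "tv_norm n v = 1 / 2 * (\<Sum>x\<in>{1..n}. \<bar>v x\<bar>)"

definition d_TV :: "nat \<Rightarrow> (nat \<Rightarrow> 'w \<Rightarrow> nat set) \<Rightarrow> nat \<Rightarrow> nat \<Rightarrow> 'w \<Rightarrow> real" where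
  "d_TV n A x0 t \<omega> = tv_norm n (\<lambda>x. block_process A x0 t \<omega> x - 1 / real n)"

text \<open>Extended-real valued, so that the infimum of the empty set is infinite.\<close>

definition t_mix :: "'w measure \<Rightarrow> nat \<Rightarrow> (nat \<Rightarrow> 'w \<Rightarrow> nat set) \<Rightarrow> nat \<Rightarrow> real \<Rightarrow> ereal" where
  "t_mix M n A x0 \<epsilon> =
     (INF t\<in>{t. integral\<^sup>L M (d_TV n A x0 t) < \<epsilon>}. ereal (real t))"

definition t_ent :: "nat \<Rightarrow> nat \<Rightarrow> real" where
  "t_ent n k = real n * ln (real n) / (real k * ln (real k))"

definition t_w :: "nat \<Rightarrow> nat \<Rightarrow> real" where
  "t_w n k = real n * sqrt (ln (real n)) / (real k * sqrt (ln (real k)))"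

text \<open>Convergence in probability to a constant; the probability space may change with the index.\<close>

definition tendsto_in_prob :: "(nat \<Rightarrow> 'w measure) \<Rightarrow> (nat \<Rightarrow> 'w \<Rightarrow> real) \<Rightarrow> real \<Rightarrow> bool" where
  "tendsto_in_prob M X c \<longleftrightarrow>
     (\<forall>\<delta>>0. (\<lambda>n. measure (M n) {\<omega> \<in> space (M n). \<bar>X n \<omega> - c\<bar> > \<delta>}) \<longlonglongrightarrow> 0)"

end

theory Submission
  imports Defs "HOL-Real_Asymp.Real_Asymp"
begin

text \<open>
  Follow a unit of mass: it is averaged at each step with probability \<open>p = k / n\<close>, and each averaging divides it
  by \<open>k\<close>. Mass averaged fewer than \<open>m\<close> times lives on at most \<open>k ^ m\<close> sites, so it is far from
  equilibrium while \<open>k ^ m\<close> is small against \<open>n\<close>; once \<open>k ^ m \<ge> n\<close> its square norm is of order \<open>t p / n\<close>, and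
  the \<open>L\<^sup>2\<close> contraction needs few further steps. Hence the distance is about the probability that a binomial
  variable with parameters \<open>t\<close> and \<open>p\<close> stays below \<open>r = ln n / ln k\<close>. As \<open>t_ent = r / p\<close> and \<open>t_w = sqrt r / p\<close>, the
  central limit theorem yields the profile when \<open>r\<close> tends to infinity. The mass with few hits concentrates because two
  units of mass soon separate and from then on are rarely hit by the same block. Conversely, if \<open>r\<close> stays
  bounded along a subsequence, \<open>t_ent + \<beta> t_w\<close> is negative there for some \<open>\<beta>\<close>, which no Gaussian profile allows.
\<close>

section \<open>Expectations over the random blocks\<close>

text \<open>Contracting the square norm directly from the Dirac mass would take about
  \<open>ln n / p\<close> steps, a factor of order \<open>ln k\<close> too many, because the little
  mass that is rarely averaged dominates this norm. Hence mass is sorted by its number of hits, and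
  the low part is given up before the contraction is applied. The lower bound on the distance holds
  for every realisation, the upper bound only in mean. Since their means agree asymptotically, it
  suffices that the low mass concentrates; no variance of the distance itself is estimated. The two
  bounds use different hit thresholds and different durations. The margins between them are at most
  of order \<open>r powr (1/4)\<close> hits: this tends to infinity, so exponentials in it vanish,
  but it is negligible against \<open>sqrt r\<close>, the scale of the Gaussian profile.\<close>

lemma finite_blocks: "finite (blocks n k)"
  unfolding blocks_def by (rule finite_subset[of _ "Pow {1..n}"]) auto

lemma card_blocks: "card (blocks n k) = n choose k"
  unfolding blocks_def using n_subsets[of "{1..n}" k] by simp

definition unif_blocks :: "nat \<Rightarrow> nat \<Rightarrow> (nat set \<Rightarrow> real) \<Rightarrow> real" where
  "unif_blocks n k h = (\<Sum>B\<in>blocks n k. h B) / real (card (blocks n k))"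

context block_choices
begin

lemma A_measurable: "1 \<le> t \<Longrightarrow> A t \<in> measurable M (count_space (blocks n k))"
  using indep unfolding indep_vars_def by auto

lemma A_in_blocks: "1 \<le> t \<Longrightarrow> \<omega> \<in> space M \<Longrightarrow> A t \<omega> \<in> blocks n k"
  using measurable_space[OF A_measurable, of t \<omega>] by simp

abbreviation choices :: "'w \<Rightarrow> nat \<Rightarrow> nat set" where
  "choices \<omega> \<equiv> \<lambda>i. A i \<omega>"

text \<open>Adaptedness is a property of functionals of a deterministic block sequence, not
  measurability for a filtration. There are finitely many histories of length \<open>t\<close>, so
  measurability and boundedness follow at once.\<close>

definition adapted :: "nat \<Rightarrow> ((nat \<Rightarrow> nat set) \<Rightarrow> 'c) \<Rightarrow> bool" where
  "adapted t h \<longleftrightarrow> (\<forall>b b'. (\<forall>i\<in>{1..t}. b i = b' i) \<longrightarrow> h b = h b')"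

lemma adapted_restrict:
  assumes "adapted t h"
  shows "h (choices \<omega>) = h (restrict (choices \<omega>) {1..t})"
  using assms[unfolded adapted_def, rule_format, of "choices \<omega>" "restrict (choices \<omega>) {1..t}"] by simp

lemma PiM_blocks:
  "PiM {1..t::nat} (\<lambda>_. count_space (blocks n k)) = count_space (PiE {1..t} (\<lambda>_. blocks n k))"
  by (rule count_space_PiM_finite) (simp_all add: countable_finite finite_blocks)

lemma restrict_measurable:
  "(\<lambda>\<omega>. restrict (choices \<omega>) {1..t}) \<in> measurable M (count_space (PiE {1..t} (\<lambda>_. blocks n k)))"
  unfolding PiM_blocks[symmetric] by (rule measurable_restrict) (auto intro: A_measurable)

lemma finite_histories: "finite (PiE {1..t::nat} (\<lambda>_. blocks n k))"
  by (intro finite_PiE finite_blocks) auto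

lemma adapted_measurable:
  fixes h :: "(nat \<Rightarrow> nat set) \<Rightarrow> real"
  assumes "adapted t h"
  shows "(\<lambda>\<omega>. h (choices \<omega>)) \<in> borel_measurable M"
  unfolding adapted_restrict[OF assms]
  by (rule measurable_compose[OF restrict_measurable]) simp

lemma adapted_integrable:
  fixes h :: "(nat \<Rightarrow> nat set) \<Rightarrow> real"
  assumes "adapted t h"
  shows "integrable M (\<lambda>\<omega>. h (choices \<omega>))"
proof (rule integrable_const_bound[where B = "Max ((\<lambda>b. \<bar>h b\<bar>) ` PiE {1..t} (\<lambda>_. blocks n k))"])
  show "AE \<omega> in M. norm (h (choices \<omega>)) \<le> Max ((\<lambda>b. \<bar>h b\<bar>) ` PiE {1..t} (\<lambda>_. blocks n k))"
  proof (rule AE_I2)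
    fix \<omega> assume "\<omega> \<in> space M"
    then have "restrict (choices \<omega>) {1..t} \<in> PiE {1..t} (\<lambda>_. blocks n k)"
      using A_in_blocks by auto
    then show "norm (h (choices \<omega>)) \<le> Max ((\<lambda>b. \<bar>h b\<bar>) ` PiE {1..t} (\<lambda>_. blocks n k))"
      unfolding adapted_restrict[OF assms] by (intro Max_ge finite_imageI finite_histories) auto
  qed
qed (rule adapted_measurable[OF assms])

lemma indep_step:
  "indep_var (count_space (PiE {1..t} (\<lambda>_. blocks n k))) (\<lambda>\<omega>. restrict (choices \<omega>) {1..t})
             (count_space (PiE {Suc t} (\<lambda>_. blocks n k))) (\<lambda>\<omega>. restrict (choices \<omega>) {Suc t})"
proof -
  have 1: "PiM {Suc t} (\<lambda>_. count_space (blocks n k)) = count_space (PiE {Suc t} (\<lambda>_. blocks n k))"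
    by (rule count_space_PiM_finite) (simp_all add: countable_finite finite_blocks)
  show ?thesis
    using indep_var_restrict[OF indep, of "{1..t}" "{Suc t}"] unfolding PiM_blocks 1 by auto
qed

lemma prob_block:
  assumes "B \<in> blocks n k"
  shows "expectation (\<lambda>\<omega>. indicator {B} (A (Suc t) \<omega>)) = 1 / real (card (blocks n k))"
proof -
  have "expectation (\<lambda>\<omega>. indicator {B} (A (Suc t) \<omega>) :: real) =
    integral\<^sup>L (distr M (count_space (blocks n k)) (A (Suc t))) (indicator {B})"
    by (rule integral_distr[symmetric]) (auto intro: A_measurable)
  also have "\<dots> = integral\<^sup>L (uniform_count_measure (blocks n k)) (indicator {B})"
    by (simp add: uniform)
  also have "\<dots> = 1 / real (card (blocks n k))"
    using assms by (subst integral_uniform_count_measure[OF finite_blocks])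
      (simp add: indicator_def finite_blocks sum.delta)
  finally show ?thesis .
qed

text \<open>This takes the place of conditioning on the first \<open>t\<close> blocks. Splitting by
  the value \<open>B\<close> of the next block gives products of a functional of the past and the
  indicator of an independent event. Every moment recursion below goes through it.\<close>

lemma expectation_step:
  fixes h :: "(nat \<Rightarrow> nat set) \<Rightarrow> nat set \<Rightarrow> real"
  assumes h: "\<And>B. adapted t (\<lambda>b. h b B)"
  shows "expectation (\<lambda>\<omega>. h (choices \<omega>) (A (Suc t) \<omega>)) =
    expectation (\<lambda>\<omega>. unif_blocks n k (h (choices \<omega>)))"
proof -
  have indep': "indep_var borel (\<lambda>\<omega>. h (choices \<omega>) B) borel (\<lambda>\<omega>. indicator {B} (A (Suc t) \<omega>) :: real)"
    for B
  proof -
    have "indep_var borel ((\<lambda>b. h b B) \<circ> (\<lambda>\<omega>. restrict (choices \<omega>) {1..t}))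
       borel ((\<lambda>b. indicator {B} (b (Suc t)) :: real) \<circ> (\<lambda>\<omega>. restrict (choices \<omega>) {Suc t}))"
      by (rule indep_var_compose[OF indep_step]) auto
    then show ?thesis
      unfolding comp_def adapted_restrict[OF h, symmetric] by simp
  qed
  have i1: "integrable M (\<lambda>\<omega>. h (choices \<omega>) B)" for B
    by (rule adapted_integrable[OF h])
  have i2: "integrable M (\<lambda>\<omega>. indicator {B} (A (Suc t) \<omega>) :: real)" for B
  proof -
    have "adapted (Suc t) (\<lambda>b. indicator {B} (b (Suc t)) :: real)" by (auto simp: adapted_def)
    from adapted_integrable[OF this] show ?thesis .
  qed
  have "expectation (\<lambda>\<omega>. h (choices \<omega>) (A (Suc t) \<omega>)) =
    expectation (\<lambda>\<omega>. \<Sum>B\<in>blocks n k. h (choices \<omega>) B * indicator {B} (A (Suc t) \<omega>))"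
  proof (rule Bochner_Integration.integral_cong[OF refl])
    fix \<omega> assume "\<omega> \<in> space M"
    then have "A (Suc t) \<omega> \<in> blocks n k" by (intro A_in_blocks) auto
    then show "h (choices \<omega>) (A (Suc t) \<omega>) =
      (\<Sum>B\<in>blocks n k. h (choices \<omega>) B * indicator {B} (A (Suc t) \<omega>))"
      by (simp add: indicator_def finite_blocks if_distrib sum.delta' cong: if_cong)
  qed
  also have "\<dots> = (\<Sum>B\<in>blocks n k. expectation (\<lambda>\<omega>. h (choices \<omega>) B * indicator {B} (A (Suc t) \<omega>)))"
    by (rule Bochner_Integration.integral_sum) (rule indep_var_integrable[OF indep' i1 i2])
  also have "\<dots> = (\<Sum>B\<in>blocks n k. expectation (\<lambda>\<omega>. h (choices \<omega>) B) / real (card (blocks n k)))"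
    by (intro sum.cong refl) (simp add: indep_var_lebesgue_integral[OF indep' i1 i2] prob_block)
  also have "\<dots> = expectation (\<lambda>\<omega>. unif_blocks n k (h (choices \<omega>)))"
    unfolding unif_blocks_def by (simp add: i1 sum_divide_distrib)
  finally show ?thesis .
qed

end

section \<open>Averages over a uniformly random block\<close>

lemma card_blocks_containing:
  assumes "S \<subseteq> {1..n}" "card S \<le> k"
  shows "card {B \<in> blocks n k. S \<subseteq> B} = (n - card S) choose (k - card S)"
proof -
  have fin: "finite S" using assms(1) finite_subset by blast
  have "bij_betw (\<lambda>C. C \<union> S) {C. C \<subseteq> {1..n} - S \<and> card C = k - card S} {B \<in> blocks n k. S \<subseteq> B}"
  proof (rule bij_betw_byWitness[where f' = "\<lambda>B. B - S"], goal_cases)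
    case 3
    show ?case
    proof (rule image_subsetI)
      fix C assume "C \<in> {C. C \<subseteq> {1..n} - S \<and> card C = k - card S}"
      then have C: "C \<subseteq> {1..n}" "C \<inter> S = {}" "card C = k - card S" by auto
      then have "card (C \<union> S) = k"
        using assms(2) fin finite_subset[OF C(1)] by (subst card_Un_disjoint) auto
      then show "C \<union> S \<in> {B \<in> blocks n k. S \<subseteq> B}"
        using C assms(1) unfolding blocks_def by auto
    qed
  next
    case 1
    show ?case by blast
  next
    case 2
    show ?case by blast
  next
    case 4
    show ?case
    proof (rule image_subsetI)
      fix B assume "B \<in> {B \<in> blocks n k. S \<subseteq> B}"
      then have B: "B \<subseteq> {1..n}" "card B = k" "S \<subseteq> B" by (simp_all add: blocks_def)
      have "card (B - S) = k - card S"
        unfolding B(2)[symmetric] using fin B(3) by (rule card_Diff_subset)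
      then show "B - S \<in> {C. C \<subseteq> {1..n} - S \<and> card C = k - card S}"
        using B(1) by blast
    qed
  qed
  then have "card {B \<in> blocks n k. S \<subseteq> B} = card {C. C \<subseteq> {1..n} - S \<and> card C = k - card S}"
    by (rule bij_betw_same_card[symmetric])
  also have "\<dots> = (n - card S) choose (k - card S)"
    using assms(1) fin by (subst n_subsets) (auto simp: card_Diff_subset)
  finally show ?thesis .
qed

text \<open>A hit raises the hit count of the mass in \<open>B\<close> by one. Mass with fewer than
  \<open>m\<close> hits after the step therefore comes, inside \<open>B\<close>, from mass with
  fewer than \<open>m - 1\<close> hits, and outside from its own level: two input vectors are
  needed.\<close>

definition mix :: "nat set \<Rightarrow> (nat \<Rightarrow> real) \<Rightarrow> (nat \<Rightarrow> real) \<Rightarrow> nat \<Rightarrow> real" where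
  "mix B u v x = (if x \<in> B then (\<Sum>y\<in>B. u y) / real (card B) else v x)"

lemma block_avg_eq_mix: "block_avg B v = mix B v v"
  by (auto simp: block_avg_def mix_def)

lemma mix_diff: "mix B (\<lambda>x. u x - u' x) (\<lambda>x. v x - v' x) x = mix B u v x - mix B u' v' x"
  by (simp add: mix_def sum_subtractf diff_divide_distrib)

lemma mix_mono: "(\<And>x. u x \<le> u' x) \<Longrightarrow> (\<And>x. v x \<le> v' x) \<Longrightarrow> mix B u v x \<le> mix B u' v' x"
  by (simp add: mix_def divide_right_mono sum_mono)

lemma unif_blocks_add: "unif_blocks n k (\<lambda>B. f B + g B) = unif_blocks n k f + unif_blocks n k g"
  by (simp add: unif_blocks_def sum.distrib add_divide_distrib)

lemma unif_blocks_diff: "unif_blocks n k (\<lambda>B. f B - g B) = unif_blocks n k f - unif_blocks n k g"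
  by (simp add: unif_blocks_def sum_subtractf diff_divide_distrib)

lemma unif_blocks_cmult: "unif_blocks n k (\<lambda>B. c * f B) = c * unif_blocks n k f"
  by (simp add: unif_blocks_def sum_distrib_left)

lemma unif_blocks_divide: "unif_blocks n k (\<lambda>B. f B / c) = unif_blocks n k f / c"
  by (simp add: unif_blocks_def sum_divide_distrib mult.commute)

lemma unif_blocks_sum: "unif_blocks n k (\<lambda>B. \<Sum>i\<in>I. f i B) = (\<Sum>i\<in>I. unif_blocks n k (f i))"
  unfolding unif_blocks_def by (subst sum.swap) (simp add: sum_divide_distrib)

lemma unif_blocks_cong:
  "(\<And>B. B \<in> blocks n k \<Longrightarrow> f B = g B) \<Longrightarrow> unif_blocks n k f = unif_blocks n k g"
  unfolding unif_blocks_def by simp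

locale block_size =
  fixes n k :: nat
  assumes k2: "2 \<le> k" and kn: "k \<le> n"
begin

definition hit :: real where "hit = real k / real n"

definition pair_hit :: real where
  "pair_hit = real k * (real k - 1) / (real n * (real n - 1))"

text \<open>The exact mean factor by which one random averaging shrinks the square norm of a vector
  with zero sum.\<close>

definition contr :: real where "contr = 1 - (real k - 1) / (real n - 1)"

text \<open>\<open>pair_hit\<close> is the probability that two distinct sites both lie in the
  block; \<open>pair_hit \<le> hit\<^sup>2\<close> says that sampling without replacement makes
  memberships negatively correlated. The last bound rests on
  \<open>k - 1 \<ge> k / 2\<close>.\<close>

lemma hit_bounds: "0 < hit" "hit \<le> 1" "0 \<le> pair_hit" "pair_hit \<le> hit\<^sup>2"
    "pair_hit = hit * (real k - 1) / (real n - 1)" "pair_hit / real k \<le> hit / real n"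
    "0 \<le> contr" "contr \<le> 1 - hit / 2"
proof -
  show "0 < hit" "hit \<le> 1" "0 \<le> pair_hit" using k2 kn by (auto simp: hit_def pair_hit_def)
  show e: "pair_hit = hit * (real k - 1) / (real n - 1)" by (simp add: hit_def pair_hit_def)
  have l: "(real k - 1) / (real n - 1) \<le> hit"
    using k2 kn by (simp add: hit_def field_simps)
  show "pair_hit \<le> hit\<^sup>2"
    using mult_left_mono[OF l, of hit] \<open>0 < hit\<close> unfolding e power2_eq_square by simp
  show "pair_hit / real k \<le> hit / real n"
    using l k2 kn by (simp add: pair_hit_def hit_def field_simps)
  show "0 \<le> contr" using l \<open>hit \<le> 1\<close> by (simp add: contr_def)
  have "hit / 2 \<le> (real k - 1) / real n"
    using k2 kn by (simp add: hit_def field_simps)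
  also have "\<dots> \<le> (real k - 1) / (real n - 1)"
    using k2 kn by (intro divide_left_mono) auto
  finally show "contr \<le> 1 - hit / 2" by (simp add: contr_def)
qed

lemma card_blocks_pos: "0 < card (blocks n k)"
  using kn by (simp add: card_blocks)

lemma unif_blocks_const: "unif_blocks n k (\<lambda>_. c) = c"
  using card_blocks_pos by (simp add: unif_blocks_def)

lemma unif_blocks_of_bool: "unif_blocks n k (\<lambda>B. of_bool (P B)) = card {B \<in> blocks n k. P B} / card (blocks n k)"
  unfolding unif_blocks_def by (simp add: finite_blocks of_bool_def Int_def flip: sum.inter_filter)

lemma unif_blocks_mem:
  assumes "x \<in> {1..n}"
  shows "unif_blocks n k (\<lambda>B. of_bool (x \<in> B)) = hit"
proof -
  obtain n' k' where nk: "n = Suc n'" "k = Suc k'" using k2 kn by (metis Suc_le_D le_trans numeral_2_eq_2)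
  have "{B \<in> blocks n k. x \<in> B} = {B \<in> blocks n k. {x} \<subseteq> B}" by auto
  then have "card {B \<in> blocks n k. x \<in> B} = n' choose k'"
    using card_blocks_containing[of "{x}" n k] assms k2 by (simp add: nk)
  moreover have "real k * real (n choose k) = real n * real (n' choose k')"
    unfolding nk of_nat_mult[symmetric] Suc_times_binomial_eq by (simp only: mult.commute)
  moreover have "0 < n choose k" "0 < n" using kn k2 by simp_all
  ultimately show ?thesis
    unfolding unif_blocks_of_bool card_blocks hit_def by (simp add: frac_eq_eq mult_ac)
qed

lemma unif_blocks_mem2:
  assumes "x \<in> {1..n}" "y \<in> {1..n}" "x \<noteq> y"
  shows "unif_blocks n k (\<lambda>B. of_bool (x \<in> B \<and> y \<in> B)) = pair_hit"
proof -
  obtain n' k' where nk: "n = Suc (Suc n')" "k = Suc (Suc k')"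
    using k2 kn by (metis Suc_le_D le_trans numeral_2_eq_2 Suc_le_mono)
  define c where "c = card {B \<in> blocks n k. x \<in> B \<and> y \<in> B}"
  have "{B \<in> blocks n k. x \<in> B \<and> y \<in> B} = {B \<in> blocks n k. {x, y} \<subseteq> B}" by auto
  then have a1: "c = n' choose k'"
    using card_blocks_containing[of "{x, y}" n k] assms k2 by (simp add: nk c_def)
  have a2: "real (Suc (Suc k')) * real (n choose k) = real (Suc (Suc n')) * real (Suc n' choose Suc k')"
    unfolding nk of_nat_mult[symmetric] Suc_times_binomial_eq by (simp only: mult.commute)
  have a3: "real (Suc k') * real (Suc n' choose Suc k') = real (Suc n') * real (n' choose k')"
    unfolding of_nat_mult[symmetric] Suc_times_binomial_eq by (simp only: mult.commute)
  have e: "real k = real (Suc (Suc k'))" "real k - 1 = real (Suc k')"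
    "real n = real (Suc (Suc n'))" "real n - 1 = real (Suc n')" by (simp_all add: nk)
  have "real k * (real k - 1) * real (n choose k) = (real k - 1) * (real k * real (n choose k))"
    by (simp only: mult_ac)
  also have "\<dots> = real (Suc k') * (real (Suc (Suc k')) * real (n choose k))"
    by (subst e(2), subst e(1), rule refl)
  also have "\<dots> = real (Suc (Suc n')) * (real (Suc k') * real (Suc n' choose Suc k'))"
    unfolding a2 by (simp only: mult_ac)
  also have "\<dots> = real n * (real n - 1) * real c"
    by (subst e(4), subst e(3), subst a1, subst a3) (simp only: mult_ac)
  finally have *: "real k * (real k - 1) * real (n choose k) = real n * (real n - 1) * real c" .
  have ne: "real (n choose k) \<noteq> 0" "real n * (real n - 1) \<noteq> 0" using kn k2 by simp_all
  show ?thesis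
    unfolding unif_blocks_of_bool card_blocks pair_hit_def c_def[symmetric] frac_eq_eq[OF ne]
    using * by (simp only: mult_ac)
qed

lemma sum_block:
  assumes "B \<in> blocks n k"
  shows "(\<Sum>y\<in>B. v y) = (\<Sum>y\<in>{1..n}. of_bool (y \<in> B) * (v y :: real))"
proof -
  have "{1..n} \<inter> B = B" using assms by (auto simp: blocks_def)
  then have "(\<Sum>y\<in>B. v y) = (\<Sum>y\<in>{1..n} \<inter> B. v y)" by simp
  also have "\<dots> = (\<Sum>y\<in>{1..n}. of_bool (y \<in> B) * v y)"
    unfolding sum.inter_restrict[OF finite_atLeastAtMost] by (rule sum.cong) auto
  finally show ?thesis .
qed

lemma unif_blocks_sum_block: "unif_blocks n k (\<lambda>B. \<Sum>y\<in>B. v y) = hit * (\<Sum>y\<in>{1..n}. v y)"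
proof -
  have "unif_blocks n k (\<lambda>B. \<Sum>y\<in>B. v y) = unif_blocks n k (\<lambda>B. \<Sum>y\<in>{1..n}. v y * of_bool (y \<in> B))"
    by (rule unif_blocks_cong) (simp add: sum_block mult.commute)
  also have "\<dots> = (\<Sum>y\<in>{1..n}. v y * hit)"
    unfolding unif_blocks_sum unif_blocks_cmult using unif_blocks_mem by (intro sum.cong) auto
  finally show ?thesis by (simp add: sum_distrib_left mult.commute)
qed

text \<open>Diagonal terms of the expanded product have probability \<open>hit\<close>, the others
  \<open>pair_hit\<close>. Treating the diagonal as an excess \<open>hit - pair_hit\<close> over a
  complete double sum brings in the total masses, which are at most 1 or vanish in the
  applications.\<close>

lemma unif_blocks_sum_block2:
  "unif_blocks n k (\<lambda>B. (\<Sum>x\<in>B. u x) * (\<Sum>y\<in>B. v y)) =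
     (hit - pair_hit) * (\<Sum>x\<in>{1..n}. u x * v x) + pair_hit * ((\<Sum>x\<in>{1..n}. u x) * (\<Sum>y\<in>{1..n}. v y))"
proof -
  have "unif_blocks n k (\<lambda>B. (\<Sum>x\<in>B. u x) * (\<Sum>y\<in>B. v y)) =
    unif_blocks n k (\<lambda>B. \<Sum>x\<in>{1..n}. \<Sum>y\<in>{1..n}. u x * v y * of_bool (x \<in> B \<and> y \<in> B))"
    by (rule unif_blocks_cong) (simp only: sum_block sum_product of_bool_conj mult_ac)
  also have "\<dots> = (\<Sum>x\<in>{1..n}. \<Sum>y\<in>{1..n}. u x * v y * unif_blocks n k (\<lambda>B. of_bool (x \<in> B \<and> y \<in> B)))"
    unfolding unif_blocks_sum unif_blocks_cmult ..
  also have "\<dots> = (\<Sum>x\<in>{1..n}. \<Sum>y\<in>{1..n}. (if x = y then u x * v x * (hit - pair_hit) else 0) + u x * v y * pair_hit)"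
    using unif_blocks_mem unif_blocks_mem2
    by (intro sum.cong refl) (auto simp: algebra_simps)
  also have "\<dots> = (hit - pair_hit) * (\<Sum>x\<in>{1..n}. u x * v x) + (\<Sum>x\<in>{1..n}. \<Sum>y\<in>{1..n}. u x * v y * pair_hit)"
    by (simp add: sum.distrib sum.delta sum_distrib_left mult_ac)
  also have "(\<Sum>x\<in>{1..n}. \<Sum>y\<in>{1..n}. u x * v y * pair_hit) = pair_hit * ((\<Sum>x\<in>{1..n}. u x) * (\<Sum>y\<in>{1..n}. v y))"
    unfolding sum_product by (simp only: sum_distrib_left sum_distrib_right mult_ac)
  finally show ?thesis .
qed

lemma sum_mix:
  assumes "B \<in> blocks n k"
  shows "(\<Sum>x\<in>{1..n}. mix B u v x) = (\<Sum>x\<in>{1..n}. v x) - (\<Sum>x\<in>B. v x) + (\<Sum>x\<in>B. u x)"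
    and "(\<Sum>x\<in>{1..n}. (mix B u v x)\<^sup>2) =
      (\<Sum>x\<in>{1..n}. (v x)\<^sup>2) - (\<Sum>x\<in>B. (v x)\<^sup>2) + (\<Sum>x\<in>B. u x) * (\<Sum>x\<in>B. u x) / real k"
proof -
  have B: "B \<subseteq> {1..n}" "card B = k" "finite B"
    using assms finite_subset by (auto simp: blocks_def)
  have split: "(\<Sum>x\<in>{1..n}. f x) = (\<Sum>x\<in>{1..n} - B. f x) + (\<Sum>x\<in>B. f x)" for f :: "nat \<Rightarrow> real"
    by (rule sum.subset_diff[OF B(1)]) simp
  show "(\<Sum>x\<in>{1..n}. mix B u v x) = (\<Sum>x\<in>{1..n}. v x) - (\<Sum>x\<in>B. v x) + (\<Sum>x\<in>B. u x)"
    unfolding split[of v] split[of "mix B u v"] using B k2 by (simp add: mix_def)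
  show "(\<Sum>x\<in>{1..n}. (mix B u v x)\<^sup>2) =
      (\<Sum>x\<in>{1..n}. (v x)\<^sup>2) - (\<Sum>x\<in>B. (v x)\<^sup>2) + (\<Sum>x\<in>B. u x) * (\<Sum>x\<in>B. u x) / real k"
    unfolding split[of "\<lambda>x. (v x)\<^sup>2"] split[of "\<lambda>x. (mix B u v x)\<^sup>2"]
    using B k2 by (simp add: mix_def power2_eq_square)
qed

lemma sum_abs_block_avg_le:
  assumes "B \<in> blocks n k"
  shows "(\<Sum>x\<in>{1..n}. \<bar>block_avg B v x\<bar>) \<le> (\<Sum>x\<in>{1..n}. \<bar>v x\<bar>)"
proof -
  have "\<bar>mix B v v x\<bar> \<le> mix B (\<lambda>x. \<bar>v x\<bar>) (\<lambda>x. \<bar>v x\<bar>) x" for x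
    by (simp add: mix_def divide_right_mono)
  then have "(\<Sum>x\<in>{1..n}. \<bar>mix B v v x\<bar>) \<le> (\<Sum>x\<in>{1..n}. mix B (\<lambda>x. \<bar>v x\<bar>) (\<lambda>x. \<bar>v x\<bar>) x)"
    by (rule sum_mono)
  then show ?thesis using sum_mix(1)[OF assms] by (simp add: block_avg_eq_mix)
qed

lemma unif_blocks_mix_sq:
  "unif_blocks n k (\<lambda>B. \<Sum>x\<in>{1..n}. (mix B u v x)\<^sup>2) =
    (1 - hit) * (\<Sum>x\<in>{1..n}. (v x)\<^sup>2) + (hit - pair_hit) / real k * (\<Sum>x\<in>{1..n}. (u x)\<^sup>2)
      + pair_hit / real k * (\<Sum>x\<in>{1..n}. u x)\<^sup>2"
proof -
  have "unif_blocks n k (\<lambda>B. \<Sum>x\<in>{1..n}. (mix B u v x)\<^sup>2) =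
    unif_blocks n k (\<lambda>B. (\<Sum>x\<in>{1..n}. (v x)\<^sup>2) - (\<Sum>x\<in>B. (v x)\<^sup>2) + (\<Sum>x\<in>B. u x) * (\<Sum>x\<in>B. u x) / real k)"
    by (rule unif_blocks_cong) (rule sum_mix)
  also have "\<dots> = (\<Sum>x\<in>{1..n}. (v x)\<^sup>2) - hit * (\<Sum>x\<in>{1..n}. (v x)\<^sup>2) +
     ((hit - pair_hit) * (\<Sum>x\<in>{1..n}. u x * u x) + pair_hit * ((\<Sum>x\<in>{1..n}. u x) * (\<Sum>y\<in>{1..n}. u y))) / real k"
    unfolding unif_blocks_add unif_blocks_diff unif_blocks_divide unif_blocks_const
      unif_blocks_sum_block unif_blocks_sum_block2 ..
  finally show ?thesis by (simp add: algebra_simps power2_eq_square add_divide_distrib diff_divide_distrib)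
qed

lemma hit_identity: "1 - hit + (hit - pair_hit) / real k = contr"
proof -
  have pos: "real n > 1" "real n > 0" "real k > 0" using k2 kn by simp_all
  have "hit / real k = 1 / real n" "pair_hit / real k = (real k - 1) / (real n * (real n - 1))"
    using pos by (simp_all add: hit_def pair_hit_def)
  then have "1 - hit + (hit - pair_hit) / real k =
      1 - (real k - 1) / real n - (real k - 1) / (real n * (real n - 1))"
    using pos by (simp add: diff_divide_distrib hit_def)
  also have "\<dots> = 1 - (real k - 1) * (1 / real n + 1 / (real n * (real n - 1)))"
    by (simp add: algebra_simps)
  also have "1 / real n + 1 / (real n * (real n - 1)) = 1 / (real n - 1)"
    using pos by (simp add: add_divide_eq_iff divide_simps)
  finally show ?thesis by (simp add: contr_def)
qed

text \<open>Zero total removes the \<open>pair_hit\<close> term, so an equality remains that can be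
  iterated without loss.\<close>

lemma unif_blocks_block_avg_sq:
  assumes "(\<Sum>x\<in>{1..n}. v x) = 0"
  shows "unif_blocks n k (\<lambda>B. \<Sum>x\<in>{1..n}. (block_avg B v x)\<^sup>2) = contr * (\<Sum>x\<in>{1..n}. (v x)\<^sup>2)"
proof -
  have "unif_blocks n k (\<lambda>B. \<Sum>x\<in>{1..n}. (block_avg B v x)\<^sup>2) =
      (1 - hit + (hit - pair_hit) / real k) * (\<Sum>x\<in>{1..n}. (v x)\<^sup>2)"
    unfolding block_avg_eq_mix unif_blocks_mix_sq using assms by (simp add: algebra_simps)
  then show ?thesis by (simp only: hit_identity)
qed

end

section \<open>The process for a fixed sequence of blocks\<close>

text \<open>The offset \<open>s\<close> lets the blocks after time \<open>s\<close> act on an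
  arbitrary vector: the upper bound restarts the dynamics at an intermediate time from only a part
  of the state.\<close>

primrec evolve :: "(nat \<Rightarrow> nat set) \<Rightarrow> nat \<Rightarrow> nat \<Rightarrow> (nat \<Rightarrow> real) \<Rightarrow> nat \<Rightarrow> real" where
  "evolve b s 0 v = v"
| "evolve b s (Suc u) v = block_avg (b (Suc (s + u))) (evolve b s u v)"

abbreviation state :: "(nat \<Rightarrow> nat set) \<Rightarrow> nat \<Rightarrow> nat \<Rightarrow> nat \<Rightarrow> real" where
  "state b x0 t \<equiv> evolve b 0 t (indicator {x0})"

text \<open>\<open>low b x0 t m\<close> is the mass that has been averaged fewer than \<open>m\<close> times by time \<open>t\<close>, and \<open>touched b x0 t j\<close>
  contains the sites carrying mass that has been averaged exactly \<open>j\<close> times.\<close>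

primrec low :: "(nat \<Rightarrow> nat set) \<Rightarrow> nat \<Rightarrow> nat \<Rightarrow> nat \<Rightarrow> nat \<Rightarrow> real" where
  "low b x0 0 = (\<lambda>m x. if m = 0 then 0 else indicator {x0} x)"
| "low b x0 (Suc t) = (\<lambda>m. mix (b (Suc t)) (low b x0 t (m - 1)) (low b x0 t m))"

primrec touched :: "(nat \<Rightarrow> nat set) \<Rightarrow> nat \<Rightarrow> nat \<Rightarrow> nat \<Rightarrow> nat set" where
  "touched b x0 0 = (\<lambda>j. if j = 0 then {x0} else {})"
| "touched b x0 (Suc t) = (\<lambda>j. (touched b x0 t j - b (Suc t)) \<union>
     (if 0 < j \<and> touched b x0 t (j - 1) \<inter> b (Suc t) \<noteq> {} then b (Suc t) else {}))"

lemma block_process_eq_state: "block_process A x0 t \<omega> = state (\<lambda>i. A i \<omega>) x0 t"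
  by (induction t) simp_all

lemma evolve_add: "evolve b s (u + u') v = evolve b (s + u) u' (evolve b s u v)"
  by (induction u') (simp_all add: add.assoc)

lemma evolve_cong: "(\<And>i. s < i \<Longrightarrow> i \<le> s + u \<Longrightarrow> b i = b' i) \<Longrightarrow> evolve b s u v = evolve b' s u v"
  by (induction u) simp_all

lemma low_cong: "(\<And>i. 0 < i \<Longrightarrow> i \<le> t \<Longrightarrow> b i = b' i) \<Longrightarrow> low b x0 t = low b' x0 t"
  by (induction t) simp_all

lemma evolve_diff: "evolve b s u (\<lambda>x. v x - w x) x = evolve b s u v x - evolve b s u w x"
proof (induction u arbitrary: x)
  case (Suc u)
  then have "evolve b s u (\<lambda>x. v x - w x) = (\<lambda>x. evolve b s u v x - evolve b s u w x)" by auto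
  then show ?case by (simp add: block_avg_eq_mix mix_diff)
qed simp

text \<open>At level 0 the index \<open>m - 1\<close> truncates to 0, so this level feeds only
  itself and stays empty. This spares the recursion of \<open>low\<close> a case
  distinction.\<close>

lemma low_0: "low b x0 t 0 x = 0"
proof (induction t arbitrary: x)
  case (Suc t)
  then have "low b x0 t 0 = (\<lambda>x. 0)" by auto
  then show ?case by (simp add: mix_def)
qed simp

lemma low_mono: "low b x0 t m x \<le> low b x0 t (Suc m) x"
proof (induction t arbitrary: m x)
  case (Suc t)
  have "low b x0 t (m - 1) x \<le> low b x0 t m x" for x
    using Suc.IH[of "m - 1" x] by (cases m) simp_all
  then show ?case using Suc.IH by (auto intro!: mix_mono)
qed simp

lemma low_nonneg: "0 \<le> low b x0 t m x"
proof (induction m)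
  case (Suc m)
  then show ?case using low_mono order_trans by blast
qed (simp add: low_0)

lemma low_le_state: "low b x0 t m x \<le> state b x0 t x"
  by (induction t arbitrary: m x) (auto simp: block_avg_eq_mix intro!: mix_mono)

text \<open>If an averaged site receives mass with fewer than \<open>m\<close> hits, some site of
  the block carried mass with \<open>j < m - 1\<close> hits, and then the whole block enters level
  \<open>j + 1\<close>.\<close>

lemma low_touched: "x \<notin> (\<Union>j<m. touched b x0 t j) \<Longrightarrow> low b x0 t m x = 0"
proof (induction t arbitrary: m x)
  case (Suc t)
  show ?case
  proof (cases "x \<in> b (Suc t)")
    case True
    have "low b x0 t (m - 1) y = 0" if y: "y \<in> b (Suc t)" for y
    proof (rule Suc.IH, rule notI)
      assume "y \<in> (\<Union>j<m - 1. touched b x0 t j)"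
      then obtain j where j: "j < m - 1" "y \<in> touched b x0 t j" by auto
      then have "x \<in> touched b x0 (Suc t) (Suc j)" using True y by auto
      moreover have "Suc j < m" using j by simp
      ultimately show False using Suc.prems by blast
    qed
    then show ?thesis using True by (simp add: mix_def)
  next
    case False
    then have "low b x0 t m x = 0" using Suc.prems by (intro Suc.IH) auto
    then show ?thesis using False by (simp add: mix_def)
  qed
qed (auto split: if_splits)

section \<open>Conservation of mass, support counts and the lower bound on the distance\<close>

context block_size
begin

definition valid :: "(nat \<Rightarrow> nat set) \<Rightarrow> bool" where
  "valid b \<longleftrightarrow> (\<forall>i\<ge>1. b i \<in> blocks n k)"

lemma validD: "valid b \<Longrightarrow> b (Suc t) \<in> blocks n k"
  by (simp add: valid_def)

lemma blocksD: "B \<in> blocks n k \<Longrightarrow> card B = k" "B \<in> blocks n k \<Longrightarrow> finite B"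
  by (auto simp: blocks_def intro: finite_subset)

lemma sum_evolve: "valid b \<Longrightarrow> (\<Sum>x\<in>{1..n}. evolve b s u v x) = (\<Sum>x\<in>{1..n}. v x)"
  by (induction u) (simp_all add: block_avg_eq_mix sum_mix(1)[OF validD] del: One_nat_def)

lemma sum_abs_evolve_le:
  "valid b \<Longrightarrow> (\<Sum>x\<in>{1..n}. \<bar>evolve b s u v x\<bar>) \<le> (\<Sum>x\<in>{1..n}. \<bar>v x\<bar>)"
proof (induction u)
  case (Suc u)
  then show ?case
    using sum_abs_block_avg_le[OF validD[OF Suc.prems], of "s + u" "evolve b s u v"] by simp
qed simp

lemma evolve_const: "valid b \<Longrightarrow> evolve b s u (\<lambda>_. c) = (\<lambda>_. c)"
proof (induction u)
  case (Suc u)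
  then show ?case
    using blocksD(1)[OF validD[OF Suc.prems, of "s + u"]] k2 by (simp add: block_avg_eq_mix mix_def fun_eq_iff)
qed simp

lemma sum_state: "valid b \<Longrightarrow> x0 \<in> {1..n} \<Longrightarrow> (\<Sum>x\<in>{1..n}. state b x0 t x) = 1"
  by (simp add: sum_evolve indicator_def del: One_nat_def)

lemma state_nonneg: "0 \<le> state b x0 t x"
  using low_nonneg[of b x0 t 0 x] low_le_state order_trans by blast

lemma sum_low_bounds:
  assumes "valid b" "x0 \<in> {1..n}"
  shows "0 \<le> (\<Sum>x\<in>{1..n}. low b x0 t m x)" "(\<Sum>x\<in>{1..n}. low b x0 t m x) \<le> 1"
proof -
  show "0 \<le> (\<Sum>x\<in>{1..n}. low b x0 t m x)" by (intro sum_nonneg low_nonneg)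
  show "(\<Sum>x\<in>{1..n}. low b x0 t m x) \<le> 1"
    unfolding sum_state[OF assms, of t, symmetric] by (intro sum_mono low_le_state)
qed

lemma finite_touched: "valid b \<Longrightarrow> finite (touched b x0 t j)"
  by (induction t arbitrary: j) (auto simp: blocksD(2)[OF validD])

text \<open>A block meeting \<open>touched b x0 t j\<close> removes at least one of its sites and creates at most \<open>k\<close> sites of
  level \<open>j + 1\<close>, so the weighted count below never increases.\<close>

lemma touched_weight:
  assumes "valid b"
  shows "(\<Sum>j<m. real (card (touched b x0 t j)) / real k ^ j) \<le> 1"
proof (induction t arbitrary: m)
  case 0
  have "(\<Sum>j<m. real (card (touched b x0 0 j)) / real k ^ j) = (\<Sum>j<m. if j = 0 then 1 else 0)"
    by (rule sum.cong) auto
  also have "\<dots> \<le> 1" by (simp add: sum.delta)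
  finally show ?case .
next
  case (Suc t)
  define B where "B = b (Suc t)"
  define R where "R = touched b x0 t"
  have B: "finite B" "card B = k" using blocksD validD[OF assms] by (simp_all add: B_def)
  have R: "finite (R j)" for j using finite_touched[OF assms] by (simp add: R_def)
  show ?case
  proof (cases m)
    case (Suc m')
    have 1: "real (card (touched b x0 (Suc t) (Suc j))) \<le>
       real (card (R (Suc j) - B)) + real k * real (card (R j \<inter> B))" for j
    proof -
      have "card (touched b x0 (Suc t) (Suc j)) \<le>
         card (R (Suc j) - B) + card (if R j \<inter> B \<noteq> {} then B else {})"
        unfolding touched.simps B_def[symmetric] R_def[symmetric] by (rule order_trans[OF card_Un_le]) simp
      also have "card (if R j \<inter> B \<noteq> {} then B else {}) \<le> k * card (R j \<inter> B)"
      proof (cases "R j \<inter> B = {}")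
        case False
        then have "1 \<le> card (R j \<inter> B)" using R B by (simp add: Suc_le_eq card_gt_0_iff)
        then show ?thesis using B False by simp
      qed simp
      finally show ?thesis by (metis add_left_mono of_nat_add of_nat_le_iff of_nat_mult)
    qed
    have "(\<Sum>j<m. real (card (touched b x0 (Suc t) j)) / real k ^ j) =
       real (card (R 0 - B)) + (\<Sum>j<m'. real (card (touched b x0 (Suc t) (Suc j))) / real k ^ Suc j)"
      unfolding Suc sum.lessThan_Suc_shift by (simp add: B_def R_def)
    also have "\<dots> \<le> real (card (R 0 - B)) +
      (\<Sum>j<m'. (real (card (R (Suc j) - B)) + real k * real (card (R j \<inter> B))) / real k ^ Suc j)"
      by (intro add_left_mono sum_mono divide_right_mono 1) simp
    also have "\<dots> = (\<Sum>j<Suc m'. real (card (R j - B)) / real k ^ j) +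
        (\<Sum>j<m'. real (card (R j \<inter> B)) / real k ^ j)"
      unfolding sum.lessThan_Suc_shift using k2
      by (simp add: add_divide_distrib sum.distrib del: sum.lessThan_Suc)
    \<comment> \<open>Hit sites of level \<open>m'\<close> move to level \<open>m\<close>, outside
      the sum. Adding their weight back lets hit and unhit sites recombine into the weight before
      the step.\<close>
    also have "\<dots> \<le> (\<Sum>j<Suc m'. real (card (R j - B)) / real k ^ j) +
        (\<Sum>j<Suc m'. real (card (R j \<inter> B)) / real k ^ j)"
      by (intro add_left_mono sum_mono2) auto
    also have "\<dots> = (\<Sum>j<Suc m'. real (card (R j)) / real k ^ j)"
    proof -
      have "card (R j) = card (R j - B) + card (R j \<inter> B)" for j
        using R[of j] by (metis Int_Diff_disjoint Int_Diff_Un Un_Diff_Int card_Un_disjoint finite_Diff finite_Int Int_commute sup_commute)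
      then show ?thesis by (simp add: add_divide_distrib sum.distrib del: sum.lessThan_Suc)
    qed
    also have "\<dots> \<le> 1" unfolding R_def by (rule Suc.IH)
    finally show ?thesis .
  qed simp
qed

text \<open>Each site of a level below \<open>m\<close> contributes at least
  \<open>1 / k ^ m\<close> to a total weight that is at most 1.\<close>

lemma card_touched_le:
  assumes "valid b"
  shows "real (card (\<Union>j<m. touched b x0 t j)) \<le> real k ^ m"
proof -
  have "real (card (\<Union>j<m. touched b x0 t j)) \<le> (\<Sum>j<m. real (card (touched b x0 t j)))"
    unfolding of_nat_sum[symmetric] of_nat_le_iff by (rule card_UN_le) simp
  also have "\<dots> \<le> (\<Sum>j<m. real k ^ m * (real (card (touched b x0 t j)) / real k ^ j))"
  proof (rule sum_mono)
    fix j assume "j \<in> {..<m}"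
    then have "real k ^ j \<le> real k ^ m" using k2 by (intro power_increasing) auto
    then have "1 \<le> real k ^ m / real k ^ j" using k2 by simp
    from mult_right_mono[OF this, of "real (card (touched b x0 t j))"]
    show "real (card (touched b x0 t j)) \<le> real k ^ m * (real (card (touched b x0 t j)) / real k ^ j)"
      by simp
  qed
  also have "\<dots> \<le> real k ^ m * 1"
    unfolding sum_distrib_left[symmetric] by (intro mult_left_mono touched_weight assms) simp
  finally show ?thesis by simp
qed

text \<open>With zero total, the sums over \<open>S\<close> and its complement are opposite, so
  twice the sum over \<open>S\<close> is at most the \<open>L1\<close> norm.\<close>

lemma tv_norm_ge:
  assumes "(\<Sum>x\<in>{1..n}. v x) = 0" "S \<subseteq> {1..n}"
  shows "(\<Sum>x\<in>S. v x) \<le> tv_norm n v"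
proof -
  have "(\<Sum>x\<in>{1..n}. v x) = (\<Sum>x\<in>{1..n} - S. v x) + (\<Sum>x\<in>S. v x)"
    "(\<Sum>x\<in>{1..n}. \<bar>v x\<bar>) = (\<Sum>x\<in>{1..n} - S. \<bar>v x\<bar>) + (\<Sum>x\<in>S. \<bar>v x\<bar>)"
    by (rule sum.subset_diff[OF assms(2)], simp)+
  moreover have "(\<Sum>x\<in>S. v x) \<le> (\<Sum>x\<in>S. \<bar>v x\<bar>)" "- (\<Sum>x\<in>{1..n} - S. v x) \<le> (\<Sum>x\<in>{1..n} - S. \<bar>v x\<bar>)"
    unfolding sum_negf[symmetric] by (intro sum_mono; simp)+
  ultimately show ?thesis using assms(1) unfolding tv_norm_def by linarith
qed

text \<open>The test set consists of the sites touched at levels below \<open>m\<close>: it carries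
  all the low mass, while its equilibrium mass is at most \<open>k ^ m / n\<close>.\<close>

lemma tv_state_ge:
  assumes "valid b" "x0 \<in> {1..n}"
  shows "(\<Sum>x\<in>{1..n}. low b x0 t m x) - real k ^ m / real n
           \<le> tv_norm n (\<lambda>x. state b x0 t x - 1 / real n)"
proof -
  define S where "S = (\<Union>j<m. touched b x0 t j) \<inter> {1..n}"
  have n: "real n > 0" using k2 kn by simp
  have "card S \<le> card (\<Union>j<m. touched b x0 t j)"
    unfolding S_def using finite_touched[OF assms(1)] by (intro card_mono) auto
  then have "real (card S) \<le> real k ^ m" using card_touched_le[OF assms(1), of x0 t m] by linarith
  then have S: "real (card S) / real n \<le> real k ^ m / real n" by (simp add: divide_right_mono)
  have "(\<Sum>x\<in>{1..n}. low b x0 t m x) = (\<Sum>x\<in>S. low b x0 t m x)"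
    proof (rule sum.mono_neutral_right)
    show "\<forall>x\<in>{1..n} - S. low b x0 t m x = 0"
    proof
      fix x assume "x \<in> {1..n} - S"
      then have "x \<notin> (\<Union>j<m. touched b x0 t j)" unfolding S_def by blast
      then show "low b x0 t m x = 0" by (rule low_touched)
    qed
  qed (auto simp: S_def)
  also have "\<dots> \<le> (\<Sum>x\<in>S. state b x0 t x)" by (intro sum_mono low_le_state)
  also have "\<dots> = (\<Sum>x\<in>S. state b x0 t x - 1 / real n) + real (card S) / real n"
    by (simp add: sum_subtractf)
  also have "(\<Sum>x\<in>S. state b x0 t x - 1 / real n) \<le> tv_norm n (\<lambda>x. state b x0 t x - 1 / real n)"
    using sum_state[OF assms, of t] n by (intro tv_norm_ge) (auto simp: sum_subtractf S_def)
  finally show ?thesis using S by linarith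
qed

end

section \<open>Moments of the process\<close>

definition binlt :: "nat \<Rightarrow> real \<Rightarrow> nat \<Rightarrow> real" where
  "binlt t p m = measure_pmf.prob (binomial_pmf t p) {..<m}"

lemma binlt_bounds: "0 \<le> binlt t p m" "binlt t p m \<le> 1"
  by (simp_all add: binlt_def)

lemma binlt_zero: "binlt t p 0 = 0"
  by (simp add: binlt_def)

lemma binlt_0: "p \<in> {0..1} \<Longrightarrow> binlt 0 p (Suc m) = 1"
  by (simp add: binlt_def binomial_pmf_0)

text \<open>Conditioning on the last trial gives the recursion in exactly the form satisfied by the
  mean low mass.\<close>

lemma binlt_Suc:
  assumes p: "p \<in> {0..1}"
  shows "binlt (Suc t) p (Suc m) = (1 - p) * binlt t p (Suc m) + p * binlt t p m"
proof -
  have 0: "pmf (binomial_pmf (Suc t) p) 0 = (1 - p) * pmf (binomial_pmf t p) 0"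
    using p by simp
  have S: "pmf (binomial_pmf (Suc t) p) (Suc j) =
      p * pmf (binomial_pmf t p) j + (1 - p) * pmf (binomial_pmf t p) (Suc j)" for j
  \<comment> \<open>For \<open>j < t\<close> neither exponent \<open>t - j\<close> nor
    \<open>t - Suc j\<close> is truncated; otherwise the coefficient \<open>t choose Suc j\<close>
    is zero.\<close>
  proof (cases "j < t")
    case True
    then obtain d where "t = Suc (j + d)" using less_imp_Suc_add by blast
    then show ?thesis using p by (simp add: algebra_simps)
  next
    case False
    then show ?thesis using p by (cases "j = t") (simp_all add: binomial_eq_0)
  qed
  have fin: "measure_pmf.prob (binomial_pmf t p) {..<m} = (\<Sum>j<m. pmf (binomial_pmf t p) j)" for t m
    by (rule measure_measure_pmf_finite) simp
  show ?thesis
    unfolding binlt_def fin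
    by (simp only: sum.lessThan_Suc_shift 0 S sum.distrib sum_distrib_left[symmetric] distrib_left add_ac)
qed

locale block_average = block_choices M n k A + block_size n k
  for M :: "'w measure" and n k A +
  fixes x0 :: nat
  assumes x0: "x0 \<in> {1..n}"
begin

lemma valid_choices: "\<omega> \<in> space M \<Longrightarrow> valid (choices \<omega>)"
  by (simp add: valid_def A_in_blocks)

lemma adaptedI: "(\<And>b b'. (\<And>i. 0 < i \<Longrightarrow> i \<le> t \<Longrightarrow> b i = b' i) \<Longrightarrow> h b = h b') \<Longrightarrow> adapted t h"
  unfolding adapted_def by (metis atLeastAtMost_iff One_nat_def Suc_le_eq)

lemma adapted_low: "adapted t (\<lambda>b. low b x0 t)"
  by (intro adaptedI low_cong)

lemma adapted_state: "adapted t (\<lambda>b. state b x0 t)"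
  by (intro adaptedI evolve_cong) simp

lemma adapted_compose: "adapted t f \<Longrightarrow> adapted t (\<lambda>b. g (f b))"
  unfolding adapted_def by metis

lemma adapted_compose2: "adapted t f \<Longrightarrow> adapted t f' \<Longrightarrow> adapted t (\<lambda>b. g (f b) (f' b))"
  unfolding adapted_def by metis

lemma adapted_evolve:
  assumes "adapted s f"
  shows "adapted (s + u) (\<lambda>b. evolve b s u (f b))"
proof (rule adaptedI)
  fix b b' :: "nat \<Rightarrow> nat set" assume *: "\<And>i. 0 < i \<Longrightarrow> i \<le> s + u \<Longrightarrow> b i = b' i"
  then have "f b = f b'" using assms unfolding adapted_def by auto
  moreover have "evolve b s u v = evolve b' s u v" for v
    using * by (intro evolve_cong) auto
  ultimately show "evolve b s u (f b) = evolve b' s u (f b')" by simp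
qed

lemma unif_blocks_sum_mix:
  "unif_blocks n k (\<lambda>B. \<Sum>x\<in>{1..n}. mix B u v x) =
     (1 - hit) * (\<Sum>x\<in>{1..n}. v x) + hit * (\<Sum>x\<in>{1..n}. u x)"
proof -
  have "unif_blocks n k (\<lambda>B. \<Sum>x\<in>{1..n}. mix B u v x) =
      unif_blocks n k (\<lambda>B. (\<Sum>x\<in>{1..n}. v x) - (\<Sum>x\<in>B. v x) + (\<Sum>x\<in>B. u x))"
    by (rule unif_blocks_cong) (rule sum_mix)
  then show ?thesis
    by (simp add: unif_blocks_add unif_blocks_diff unif_blocks_const unif_blocks_sum_block algebra_simps)
qed

abbreviation low_mass :: "nat \<Rightarrow> nat \<Rightarrow> 'w \<Rightarrow> real" where
  "low_mass t m \<omega> \<equiv> \<Sum>x\<in>{1..n}. low (choices \<omega>) x0 t m x"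

abbreviation state_sq :: "nat \<Rightarrow> real" where
  "state_sq t \<equiv> expectation (\<lambda>\<omega>. \<Sum>x\<in>{1..n}. (state (choices \<omega>) x0 t x)\<^sup>2)"

lemma integrable_low_mass: "integrable M (low_mass t m)"
  using adapted_compose[OF adapted_low, of t "\<lambda>l. \<Sum>x\<in>{1..n}. l m x"] by (rule adapted_integrable)

lemma integrable_low_mass2: "integrable M (\<lambda>\<omega>. low_mass t a \<omega> * low_mass t b \<omega>)"
  using adapted_compose[OF adapted_low, of t "\<lambda>l. (\<Sum>x\<in>{1..n}. l a x) * (\<Sum>x\<in>{1..n}. l b x)"]
  by (rule adapted_integrable)

lemma integrable_state_sq: "integrable M (\<lambda>\<omega>. \<Sum>x\<in>{1..n}. (state (choices \<omega>) x0 t x)\<^sup>2)"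
  using adapted_compose[OF adapted_state, of t "\<lambda>l. \<Sum>x\<in>{1..n}. (l x)\<^sup>2"] by (rule adapted_integrable)

lemma hit_mem: "hit \<in> {0..1}"
  using hit_bounds by auto

text \<open>Every site is hit with the same probability, so the positions of the mass do not matter
  for the mean: it obeys the recursion \<open>binlt_Suc\<close> with the same initial values, and
  the identity is exact.\<close>

lemma expectation_low_mass: "expectation (low_mass t m) = binlt t hit m"
proof (induction t arbitrary: m)
  case 0
  show ?case
    using x0 hit_mem by (cases m) (simp_all add: binlt_zero binlt_0 indicator_def prob_space)
next
  case (Suc t)
  show ?case
  proof (cases m)
    case 0
    show ?thesis unfolding 0 by (simp only: low_0 binlt_zero) simp
  next
    case (Suc m')
    have "expectation (low_mass (Suc t) m) =
      expectation (\<lambda>\<omega>. unif_blocks n k (\<lambda>B. \<Sum>x\<in>{1..n}. mix B (low (choices \<omega>) x0 t (m - 1)) (low (choices \<omega>) x0 t m) x))"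
      unfolding low.simps
      by (rule expectation_step[where h = "\<lambda>b B. \<Sum>x\<in>{1..n}. mix B (low b x0 t (m - 1)) (low b x0 t m) x"])
         (rule adapted_compose[OF adapted_low])
    also have "\<dots> = expectation (\<lambda>\<omega>. (1 - hit) * low_mass t m \<omega> + hit * low_mass t (m - 1) \<omega>)"
      unfolding unif_blocks_sum_mix ..
    also have "\<dots> = (1 - hit) * expectation (low_mass t m) + hit * expectation (low_mass t (m - 1))"
      using integrable_low_mass by simp
    finally show ?thesis unfolding Suc.IH by (simp add: \<open>m = Suc m'\<close> binlt_Suc[OF hit_mem])
  qed
qed

text \<open>The differences \<open>u - u'\<close> and \<open>w - w'\<close> are what a hit removes.
  Mass at two distinct sites is hit jointly with probability at most \<open>hit\<^sup>2\<close>, as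
  under independence; only coinciding sites, on the diagonal, need the extra term.\<close>

lemma unif_blocks_mix_product_le:
  assumes u: "\<And>x. u' x \<le> u x" and w: "\<And>x. w' x \<le> w x"
  shows "unif_blocks n k (\<lambda>B. (\<Sum>x\<in>{1..n}. mix B u' u x) * (\<Sum>x\<in>{1..n}. mix B w' w x)) \<le>
     ((1 - hit) * (\<Sum>x\<in>{1..n}. u x) + hit * (\<Sum>x\<in>{1..n}. u' x)) *
     ((1 - hit) * (\<Sum>x\<in>{1..n}. w x) + hit * (\<Sum>x\<in>{1..n}. w' x)) +
     hit * (\<Sum>x\<in>{1..n}. (u x - u' x) * (w x - w' x))"
proof -
  define U W DU DW S where "U = (\<Sum>x\<in>{1..n}. u x)" "W = (\<Sum>x\<in>{1..n}. w x)"
    "DU = (\<Sum>x\<in>{1..n}. u x - u' x)" "DW = (\<Sum>x\<in>{1..n}. w x - w' x)"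
    "S = (\<Sum>x\<in>{1..n}. (u x - u' x) * (w x - w' x))"
  note defs = this
  have D: "(1 - hit) * (\<Sum>x\<in>{1..n}. u x) + hit * (\<Sum>x\<in>{1..n}. u' x) = U - hit * DU"
    "(1 - hit) * (\<Sum>x\<in>{1..n}. w x) + hit * (\<Sum>x\<in>{1..n}. w' x) = W - hit * DW"
    by (simp_all add: defs sum_subtractf algebra_simps)
  have pos: "0 \<le> DU" "0 \<le> DW" "0 \<le> S"
    using u w by (auto simp: defs intro!: sum_nonneg)
  have "unif_blocks n k (\<lambda>B. (\<Sum>x\<in>{1..n}. mix B u' u x) * (\<Sum>x\<in>{1..n}. mix B w' w x)) =
     unif_blocks n k (\<lambda>B. U * W - U * (\<Sum>x\<in>B. w x - w' x) - W * (\<Sum>x\<in>B. u x - u' x) +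
        (\<Sum>x\<in>B. u x - u' x) * (\<Sum>x\<in>B. w x - w' x))"
    by (rule unif_blocks_cong) (simp only: sum_mix(1) defs sum_subtractf, simp add: algebra_simps)
  also have "\<dots> = U * W - U * (hit * DW) - W * (hit * DU) + ((hit - pair_hit) * S + pair_hit * (DU * DW))"
    unfolding unif_blocks_add unif_blocks_diff unif_blocks_cmult unif_blocks_const
      unif_blocks_sum_block unif_blocks_sum_block2 by (simp only: defs)
  also have "\<dots> \<le> U * W - U * (hit * DW) - W * (hit * DU) + (hit * S + hit\<^sup>2 * (DU * DW))"
    using pos hit_bounds by (intro add_left_mono add_mono mult_right_mono) auto
  also have "\<dots> = (U - hit * DU) * (W - hit * DW) + hit * S"
    by (simp add: algebra_simps power2_eq_square)
  finally show ?thesis unfolding D by (simp only: defs)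
qed

text \<open>Two units of mass sampled independently from the current state share a site with
  probability equal to its square norm, and each such coincidence costs at most \<open>hit\<close>.
  Hits before time \<open>s\<close> are ignored, which only weakens the upper bound: at that stage
  the state is still too concentrated for the error sum to be small.\<close>

lemma expectation_low_mass_product:
  "expectation (\<lambda>\<omega>. low_mass (s + u) a \<omega> * low_mass (s + u) b \<omega>) \<le>
     binlt u hit a * binlt u hit b + hit * (\<Sum>v<u. state_sq (s + v))"
proof (induction u arbitrary: a b)
  case 0
  have 1: "expectation (\<lambda>\<omega>. low_mass s a \<omega> * low_mass s b \<omega>) \<le> expectation (\<lambda>\<omega>. 1)"
  proof (rule integral_mono)
    fix \<omega> assume "\<omega> \<in> space M"
    from sum_low_bounds[OF valid_choices[OF this] x0, of s]
    show "low_mass s a \<omega> * low_mass s b \<omega> \<le> 1" by (simp add: mult_le_one)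
  qed (rule integrable_low_mass2, simp)
  show ?case
  proof (cases "a = 0 \<or> b = 0")
    case True
    then have "(\<lambda>\<omega>. low_mass s a \<omega> * low_mass s b \<omega>) = (\<lambda>\<omega>. 0)" by (auto simp: low_0)
    then show ?thesis using binlt_bounds by simp
  next
    case False
    then show ?thesis using 1 hit_mem by (auto simp: gr0_conv_Suc binlt_0 prob_space)
  qed
next
  case (Suc u)
  let ?t = "s + u"
  have sq: "0 \<le> state_sq t" for t by (intro Bochner_Integration.integral_nonneg) (simp add: sum_nonneg)
  show ?case
  proof (cases "a = 0 \<or> b = 0")
    case True
    then have "(\<lambda>\<omega>. low_mass (s + Suc u) a \<omega> * low_mass (s + Suc u) b \<omega>) = (\<lambda>\<omega>. 0)" by (elim disjE) (simp_all only: low_0 sum.neutral_const mult_zero_left mult_zero_right)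
    moreover have "0 \<le> hit * (\<Sum>v<Suc u. state_sq (s + v))"
      using hit_bounds sq by (intro mult_nonneg_nonneg sum_nonneg) auto
    ultimately show ?thesis using binlt_bounds by simp
  next
    case False
    then obtain a' b' where ab: "a = Suc a'" "b = Suc b'" by (auto simp: gr0_conv_Suc)
    define E where "E = hit * (\<Sum>v<u. state_sq (s + v))"
    have "expectation (\<lambda>\<omega>. low_mass (Suc ?t) a \<omega> * low_mass (Suc ?t) b \<omega>) =
      expectation (\<lambda>\<omega>. unif_blocks n k (\<lambda>B.
         (\<Sum>x\<in>{1..n}. mix B (low (choices \<omega>) x0 ?t (a - 1)) (low (choices \<omega>) x0 ?t a) x) *
         (\<Sum>x\<in>{1..n}. mix B (low (choices \<omega>) x0 ?t (b - 1)) (low (choices \<omega>) x0 ?t b) x)))"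
      (is "_ = expectation ?L")
      unfolding low.simps
      by (rule expectation_step[where h = "\<lambda>c B. (\<Sum>x\<in>{1..n}. mix B (low c x0 ?t (a - 1)) (low c x0 ?t a) x) *
         (\<Sum>x\<in>{1..n}. mix B (low c x0 ?t (b - 1)) (low c x0 ?t b) x)"])
         (rule adapted_compose[OF adapted_low])
    also have "\<dots> \<le> expectation (\<lambda>\<omega>. (1 - hit)\<^sup>2 * (low_mass ?t a \<omega> * low_mass ?t b \<omega>) +
        (1 - hit) * hit * (low_mass ?t a \<omega> * low_mass ?t b' \<omega>) +
        hit * (1 - hit) * (low_mass ?t a' \<omega> * low_mass ?t b \<omega>) +
        hit\<^sup>2 * (low_mass ?t a' \<omega> * low_mass ?t b' \<omega>) +
        hit * (\<Sum>x\<in>{1..n}. (state (choices \<omega>) x0 ?t x)\<^sup>2))" (is "_ \<le> expectation ?R")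
    proof (rule integral_mono)
      show "integrable M ?L"
        by (rule adapted_integrable[where t = ?t]) (rule adapted_compose[OF adapted_low])
      show "integrable M ?R" using integrable_low_mass2 integrable_state_sq by simp
      fix \<omega> assume "\<omega> \<in> space M"
      let ?l = "low (choices \<omega>) x0 ?t"
      have le: "?l (m - 1) x \<le> ?l m x" for m x
        using low_mono[of _ _ _ "m - 1"] by (cases m) auto
      \<comment> \<open>The differences are the masses with exactly \<open>a - 1\<close> and
        \<open>b - 1\<close> hits, each a part of the state at the site.\<close>
      have "(\<Sum>x\<in>{1..n}. (?l a x - ?l (a - 1) x) * (?l b x - ?l (b - 1) x)) \<le>
          (\<Sum>x\<in>{1..n}. (state (choices \<omega>) x0 ?t x)\<^sup>2)"
      proof (rule sum_mono)
        fix x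
        have "?l m x - ?l (m - 1) x \<le> state (choices \<omega>) x0 ?t x" for m
          using low_le_state[of "choices \<omega>" x0 ?t m x] low_nonneg[of "choices \<omega>" x0 ?t "m - 1" x] by linarith
        then show "(?l a x - ?l (a - 1) x) * (?l b x - ?l (b - 1) x) \<le> (state (choices \<omega>) x0 ?t x)\<^sup>2"
          unfolding power2_eq_square using le by (intro mult_mono) (auto simp: state_nonneg)
      qed
      from mult_left_mono[OF this, of hit] hit_bounds(1)
        unif_blocks_mix_product_le[of "?l (a - 1)" "?l a" "?l (b - 1)" "?l b", OF le le]
      have "?L \<omega> \<le> ((1 - hit) * low_mass ?t a \<omega> + hit * low_mass ?t (a - 1) \<omega>) *
         ((1 - hit) * low_mass ?t b \<omega> + hit * low_mass ?t (b - 1) \<omega>) +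
         hit * (\<Sum>x\<in>{1..n}. (state (choices \<omega>) x0 ?t x)\<^sup>2)"
        by linarith
      also have "\<dots> = ?R \<omega>" by (simp add: ab power2_eq_square algebra_simps)
      finally show "?L \<omega> \<le> ?R \<omega>" .
    qed
    also have "\<dots> = (1 - hit)\<^sup>2 * expectation (\<lambda>\<omega>. low_mass ?t a \<omega> * low_mass ?t b \<omega>) +
        (1 - hit) * hit * expectation (\<lambda>\<omega>. low_mass ?t a \<omega> * low_mass ?t b' \<omega>) +
        hit * (1 - hit) * expectation (\<lambda>\<omega>. low_mass ?t a' \<omega> * low_mass ?t b \<omega>) +
        hit\<^sup>2 * expectation (\<lambda>\<omega>. low_mass ?t a' \<omega> * low_mass ?t b' \<omega>) + hit * state_sq ?t"
      using integrable_low_mass2 integrable_state_sq by simp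
    \<comment> \<open>The four weights add up to 1, so the inherited error \<open>E\<close> is
      passed on without growth.\<close>
    also have "\<dots> \<le> (1 - hit)\<^sup>2 * (binlt u hit a * binlt u hit b + E) +
        (1 - hit) * hit * (binlt u hit a * binlt u hit b' + E) +
        hit * (1 - hit) * (binlt u hit a' * binlt u hit b + E) +
        hit\<^sup>2 * (binlt u hit a' * binlt u hit b' + E) + hit * state_sq ?t"
      unfolding E_def using hit_bounds by (intro add_mono mult_left_mono Suc.IH) auto
    also have "\<dots> = binlt (Suc u) hit a * binlt (Suc u) hit b + (E + hit * state_sq ?t)"
      unfolding ab binlt_Suc[OF hit_mem] by (simp add: power2_eq_square algebra_simps)
    also have "E + hit * state_sq ?t = hit * (\<Sum>v<Suc u. state_sq (s + v))"
      by (simp add: E_def algebra_simps)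
    finally show ?thesis by simp
  qed
qed

end

lemma sum_sq_shift:
  "(\<Sum>x\<in>{1..n}. (v x - c :: real)\<^sup>2) =
     (\<Sum>x\<in>{1..n}. (v x)\<^sup>2) - 2 * c * (\<Sum>x\<in>{1..n}. v x) + real n * c\<^sup>2"
  by (simp add: power2_diff sum.distrib sum_subtractf sum_distrib_left mult_ac)

section \<open>Square norms, contraction and the upper bound on the mean distance\<close>

context block_average
begin

abbreviation high :: "(nat \<Rightarrow> nat set) \<Rightarrow> nat \<Rightarrow> nat \<Rightarrow> nat \<Rightarrow> real" where
  "high b t m \<equiv> \<lambda>x. state b x0 t x - low b x0 t m x"

lemma adapted_high: "adapted t (\<lambda>b. high b t m)"
  by (rule adapted_compose2[OF adapted_state adapted_low])

lemma high_Suc: "high b (Suc t) m x = mix (b (Suc t)) (high b t (m - 1)) (high b t m) x"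
  by (simp add: mix_diff block_avg_eq_mix)

lemma sum_high_bounds:
  assumes "valid b"
  shows "0 \<le> (\<Sum>x\<in>{1..n}. high b t m x)" "(\<Sum>x\<in>{1..n}. high b t m x) \<le> 1"
    "(\<Sum>x\<in>{1..n}. high b t m x) = 1 - (\<Sum>x\<in>{1..n}. low b x0 t m x)"
  using sum_low_bounds[OF assms x0, of t m] sum_state[OF assms x0, of t]
  by (simp_all only: sum_subtractf)

text \<open>A hit divides the square norm of isolated mass by \<open>k\<close>, which accounts for
  \<open>1 / k ^ m\<close>. Meetings of mass inside a block add at most \<open>pair_hit / k\<close>
  per step, because the total high mass is at most 1. The weights \<open>1 - hit\<close> at level
  \<open>m\<close> and \<open>hit / k\<close> at level \<open>m - 1\<close> do not amplify either
  term, so the second grows only linearly.\<close>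

lemma expectation_high_sq:
  "expectation (\<lambda>\<omega>. \<Sum>x\<in>{1..n}. (high (choices \<omega>) t m x)\<^sup>2) \<le> 1 / real k ^ m + real t * (pair_hit / real k)"
proof (induction t arbitrary: m)
  case 0
  show ?case
    using x0 k2 by (cases m) (simp_all add: indicator_def prob_space power2_eq_square)
next
  case (Suc t)
  let ?q = "pair_hit / real k"
  let ?H = "\<lambda>m \<omega>. \<Sum>x\<in>{1..n}. (high (choices \<omega>) t m x)\<^sup>2"
  have int: "integrable M (?H m)" for m
    by (rule adapted_integrable[where t = t]) (rule adapted_compose[OF adapted_high])
  have q: "0 \<le> ?q" "0 \<le> (hit - pair_hit) / real k" "(hit - pair_hit) / real k \<le> hit / real k" "0 \<le> 1 - hit"
    "hit / real k \<le> hit"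
  proof -
    have "hit\<^sup>2 \<le> hit" using hit_bounds(1,2) by (simp add: power2_eq_square mult_left_le)
    then have "pair_hit \<le> hit" using hit_bounds(4) by linarith
    then show "0 \<le> (hit - pair_hit) / real k" by simp
    show "0 \<le> ?q" using hit_bounds(3) by simp
    show "(hit - pair_hit) / real k \<le> hit / real k" using hit_bounds(3) by (simp add: divide_right_mono)
    show "0 \<le> 1 - hit" using hit_bounds by simp
    show "hit / real k \<le> hit" using hit_bounds(1) k2 by (simp add: field_simps)
  qed
  have "expectation (\<lambda>\<omega>. \<Sum>x\<in>{1..n}. (high (choices \<omega>) (Suc t) m x)\<^sup>2) =
     expectation (\<lambda>\<omega>. unif_blocks n k (\<lambda>B. \<Sum>x\<in>{1..n}. (mix B (high (choices \<omega>) t (m - 1)) (high (choices \<omega>) t m) x)\<^sup>2))"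
    unfolding high_Suc
    by (rule expectation_step[where h = "\<lambda>b B. \<Sum>x\<in>{1..n}. (mix B (high b t (m - 1)) (high b t m) x)\<^sup>2"])
       (rule adapted_compose2[OF adapted_high adapted_high])
  also have "\<dots> = expectation (\<lambda>\<omega>. (1 - hit) * ?H m \<omega> + (hit - pair_hit) / real k * ?H (m - 1) \<omega>
      + ?q * (\<Sum>x\<in>{1..n}. high (choices \<omega>) t (m - 1) x)\<^sup>2)"
    unfolding unif_blocks_mix_sq ..
  also have "\<dots> \<le> expectation (\<lambda>\<omega>. (1 - hit) * ?H m \<omega> + (hit - pair_hit) / real k * ?H (m - 1) \<omega> + ?q)"
  proof (rule integral_mono)
    have "integrable M (\<lambda>\<omega>. (\<Sum>x\<in>{1..n}. high (choices \<omega>) t (m - 1) x)\<^sup>2)"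
      by (rule adapted_integrable[where t = t]) (rule adapted_compose[OF adapted_high])
    then show "integrable M (\<lambda>\<omega>. (1 - hit) * ?H m \<omega> + (hit - pair_hit) / real k * ?H (m - 1) \<omega>
      + ?q * (\<Sum>x\<in>{1..n}. high (choices \<omega>) t (m - 1) x)\<^sup>2)"
      by (intro Bochner_Integration.integrable_add integrable_mult_right int)
    show "integrable M (\<lambda>\<omega>. (1 - hit) * ?H m \<omega> + (hit - pair_hit) / real k * ?H (m - 1) \<omega> + ?q)"
      by (intro Bochner_Integration.integrable_add integrable_mult_right int) simp
    fix \<omega> assume "\<omega> \<in> space M"
    from sum_high_bounds[OF valid_choices[OF this], of t "m - 1"]
    have "(\<Sum>x\<in>{1..n}. high (choices \<omega>) t (m - 1) x)\<^sup>2 \<le> 1" by (intro power_le_one)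
    then show "(1 - hit) * ?H m \<omega> + (hit - pair_hit) / real k * ?H (m - 1) \<omega>
      + ?q * (\<Sum>x\<in>{1..n}. high (choices \<omega>) t (m - 1) x)\<^sup>2 \<le>
        (1 - hit) * ?H m \<omega> + (hit - pair_hit) / real k * ?H (m - 1) \<omega> + ?q"
      using q(1) by (intro add_left_mono mult_left_le)
  qed
  also have "\<dots> = (1 - hit) * expectation (?H m) + (hit - pair_hit) / real k * expectation (?H (m - 1)) + ?q"
    using int by (simp add: prob_space del: One_nat_def)
  also have "\<dots> \<le> (1 - hit) * (1 / real k ^ m + real t * ?q) + hit / real k * (1 / real k ^ (m - 1) + real t * ?q) + ?q"
  proof (intro add_right_mono add_mono mult_left_mono Suc.IH)
    have "0 \<le> expectation (?H (m - 1))" by (intro Bochner_Integration.integral_nonneg) (simp add: sum_nonneg)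
    then show "(hit - pair_hit) / real k * expectation (?H (m - 1)) \<le> hit / real k * (1 / real k ^ (m - 1) + real t * ?q)"
      using q Suc.IH[of "m - 1"] hit_bounds(1,3) by (intro mult_mono) auto
  qed (use q in auto)
  also have "\<dots> \<le> 1 / real k ^ m + real (Suc t) * ?q"
  proof -
    \<comment> \<open>For positive \<open>m\<close> this is an equality. At \<open>m = 0\<close> the
      level \<open>m - 1\<close> is again 0, and \<open>hit / k \<le> hit\<close> suffices.\<close>
    have "hit / real k * (1 / real k ^ (m - 1)) \<le> hit * (1 / real k ^ m)"
      using k2 q(5) by (cases m) (simp_all add: mult.commute)
    moreover have "hit / real k * (real t * ?q) \<le> hit * (real t * ?q)"
      using q(5) hit_bounds(3) by (intro mult_right_mono) auto
    ultimately have "hit / real k * (1 / real k ^ (m - 1) + real t * ?q) \<le> hit * (1 / real k ^ m) + hit * (real t * ?q)"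
      unfolding distrib_left by (rule add_mono)
    moreover have "(1 - hit) * (1 / real k ^ m + real t * ?q) =
        1 / real k ^ m + real t * ?q - (hit * (1 / real k ^ m) + hit * (real t * ?q))"
      by (simp only: left_diff_distrib distrib_left mult_1_left)
    moreover have "real (Suc t) * ?q = real t * ?q + ?q"
      by (simp only: of_nat_Suc distrib_right mult_1_left add.commute)
    moreover have "d + c + q \<le> x + s" if "c \<le> hx + hy" "d = x + y - (hx + hy)" "s = y + q"
      for c d q s x y hx hy :: real
      using that by linarith
    ultimately show ?thesis by blast
  qed
  finally show ?case .
qed

text \<open>Averaging preserves a zero sum, so the one-step factor applies each time. The starting
  vector may depend on the first \<open>s\<close> blocks, since the factor stems from the later,
  independent ones.\<close>

lemma expectation_evolve_sq:
  assumes f: "adapted s f" and sum0: "\<And>b. valid b \<Longrightarrow> (\<Sum>x\<in>{1..n}. f b x) = 0"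
  shows "expectation (\<lambda>\<omega>. \<Sum>x\<in>{1..n}. (evolve (choices \<omega>) s u (f (choices \<omega>)) x)\<^sup>2) =
    contr ^ u * expectation (\<lambda>\<omega>. \<Sum>x\<in>{1..n}. (f (choices \<omega>) x)\<^sup>2)"
proof (induction u)
  case (Suc u)
  let ?f = "\<lambda>b. evolve b s u (f b)"
  have "expectation (\<lambda>\<omega>. \<Sum>x\<in>{1..n}. (evolve (choices \<omega>) s (Suc u) (f (choices \<omega>)) x)\<^sup>2) =
    expectation (\<lambda>\<omega>. unif_blocks n k (\<lambda>B. \<Sum>x\<in>{1..n}. (block_avg B (?f (choices \<omega>)) x)\<^sup>2))"
    unfolding evolve.simps
    by (rule expectation_step[where h = "\<lambda>b B. \<Sum>x\<in>{1..n}. (block_avg B (?f b) x)\<^sup>2"])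
       (rule adapted_compose[OF adapted_evolve[OF f]])
  also have "\<dots> = expectation (\<lambda>\<omega>. contr * (\<Sum>x\<in>{1..n}. (?f (choices \<omega>) x)\<^sup>2))"
  proof (rule Bochner_Integration.integral_cong[OF refl])
    fix \<omega> assume "\<omega> \<in> space M"
    from valid_choices[OF this]
    show "unif_blocks n k (\<lambda>B. \<Sum>x\<in>{1..n}. (block_avg B (?f (choices \<omega>)) x)\<^sup>2) =
       contr * (\<Sum>x\<in>{1..n}. (?f (choices \<omega>) x)\<^sup>2)"
      by (intro unif_blocks_block_avg_sq) (simp only: sum_evolve sum0)
  qed
  finally show ?case using Suc.IH by simp
qed simp

lemma n_pos: "0 < real n"
  using k2 kn by simp

lemma evolve_centered: "valid b \<Longrightarrow> evolve b s u (\<lambda>x. v x - c) x = evolve b s u v x - c"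
  by (simp add: evolve_diff evolve_const)

lemma state_sq_le: "state_sq t \<le> 1 / real n + contr ^ t"
proof -
  have dev: "(\<Sum>x\<in>{1..n}. (state b x0 t x - 1 / real n)\<^sup>2) = (\<Sum>x\<in>{1..n}. (state b x0 t x)\<^sup>2) - 1 / real n"
    if "valid b" for b t
    unfolding sum_sq_shift[of "state b x0 t"] sum_state[OF that x0]
    using n_pos by (simp add: power2_eq_square del: One_nat_def)
  have int: "integrable M (\<lambda>\<omega>. \<Sum>x\<in>{1..n}. (state (choices \<omega>) x0 t x)\<^sup>2)" by (rule integrable_state_sq)
  have "state_sq t - 1 / real n = expectation (\<lambda>\<omega>. (\<Sum>x\<in>{1..n}. (state (choices \<omega>) x0 t x)\<^sup>2) - 1 / real n)"
    using int by (simp add: prob_space del: One_nat_def)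
  also have "\<dots> = expectation (\<lambda>\<omega>. \<Sum>x\<in>{1..n}. (evolve (choices \<omega>) 0 t (\<lambda>x. indicator {x0} x - 1 / real n) x)\<^sup>2)"
    by (rule Bochner_Integration.integral_cong[OF refl])
       (simp only: dev[OF valid_choices, symmetric] evolve_centered[OF valid_choices])
  also have "\<dots> = contr ^ t * expectation (\<lambda>\<omega>. \<Sum>x\<in>{1..n}. (indicator {x0} x - 1 / real n)\<^sup>2)"
    by (rule expectation_evolve_sq[where f = "\<lambda>_ x. indicator {x0} x - 1 / real n"])
       (use x0 n_pos in \<open>auto simp: adapted_def sum_subtractf indicator_def\<close>)
  also have "\<dots> \<le> contr ^ t * 1"
  proof (rule mult_left_mono)
    have "(\<Sum>x\<in>{1..n}. (indicator {x0} x - 1 / real n)\<^sup>2) = (\<Sum>x\<in>{1..n}. (indicator {x0} x)\<^sup>2) - 1 / real n"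
      if "valid b" for b :: "nat \<Rightarrow> nat set"
      using dev[OF that, of 0] by simp
    \<comment> \<open>The identity does not mention \<open>b\<close>; a sample point is taken merely
      to have one valid block sequence.\<close>
    moreover obtain \<omega> where "\<omega> \<in> space M" using not_empty by blast
    ultimately have "(\<Sum>x\<in>{1..n}. (indicator {x0} x - 1 / real n)\<^sup>2) = (\<Sum>x\<in>{1..n}. (indicator {x0} x)\<^sup>2) - 1 / real n"
      using valid_choices by blast
    also have "\<dots> \<le> 1" using x0 by (simp add: indicator_def power2_eq_square)
    finally show "expectation (\<lambda>\<omega>. \<Sum>x\<in>{1..n}. (indicator {x0} x - 1 / real n)\<^sup>2) \<le> 1"
      by (simp add: prob_space del: One_nat_def)
  qed (simp add: hit_bounds)
  finally show ?thesis by simp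
qed

lemma d_TV_eq: "d_TV n A x0 t \<omega> = tv_norm n (\<lambda>x. state (choices \<omega>) x0 t x - 1 / real n)"
  by (simp add: d_TV_def block_process_eq_state)

lemma integrable_d_TV: "integrable M (d_TV n A x0 t)"
proof -
  have "integrable M (\<lambda>\<omega>. tv_norm n (\<lambda>x. state (choices \<omega>) x0 t x - 1 / real n))"
    by (rule adapted_integrable[where t = t]) (rule adapted_compose[OF adapted_state])
  then show ?thesis by (simp add: d_TV_eq[abs_def])
qed

lemma d_TV_ge: "\<omega> \<in> space M \<Longrightarrow> low_mass t m \<omega> - real k ^ m / real n \<le> d_TV n A x0 t \<omega>"
  unfolding d_TV_eq by (rule tv_state_ge[OF valid_choices x0])

text \<open>Averaging fixes the uniform vector and does not increase the \<open>L1\<close> norm,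
  whatever the block.\<close>

lemma d_TV_Suc_le: "\<omega> \<in> space M \<Longrightarrow> d_TV n A x0 (Suc t) \<omega> \<le> d_TV n A x0 t \<omega>"
proof -
  assume "\<omega> \<in> space M"
  note v = valid_choices[OF this]
  have "state (choices \<omega>) x0 (Suc t) x - 1 / real n = evolve (choices \<omega>) t 1 (\<lambda>x. state (choices \<omega>) x0 t x - 1 / real n) x" for x
    unfolding evolve_centered[OF v] by simp
  then show ?thesis
    unfolding d_TV_eq tv_norm_def using sum_abs_evolve_le[OF v, of t 1] by simp
qed

lemma expectation_d_TV_antimono: "s \<le> t \<Longrightarrow> expectation (d_TV n A x0 t) \<le> expectation (d_TV n A x0 s)"
  by (rule lift_Suc_antimono_le[of "\<lambda>t. expectation (d_TV n A x0 t)"])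
     (intro integral_mono integrable_d_TV d_TV_Suc_le)

lemma d_TV_0: "d_TV n A x0 0 \<omega> = 1 - 1 / real n"
proof -
  have "(\<Sum>x\<in>{1..n}. \<bar>indicator {x0} x - 1 / real n\<bar>) =
    (\<Sum>x\<in>{1..n} - {x0}. \<bar>indicator {x0} x - 1 / real n\<bar>) + \<bar>1 - 1 / real n\<bar>"
    using x0 by (subst sum.remove[of _ x0]) auto
  also have "(\<Sum>x\<in>{1..n} - {x0}. \<bar>indicator {x0} x - 1 / real n\<bar>) = (\<Sum>x\<in>{1..n} - {x0}. 1 / real n)"
    by (rule sum.cong) auto
  also have "\<dots> = 1 - 1 / real n"
    using x0 n_pos by (simp add: field_simps of_nat_diff)
  also have "\<bar>1 - 1 / real n\<bar> = 1 - 1 / real n" using k2 kn by (simp add: field_simps)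
  finally show ?thesis by (simp add: d_TV_def tv_norm_def del: One_nat_def)
qed

text \<open>Mass averaged fewer than \<open>m\<close> times by time \<open>T\<close> is given up; the rest is already spread out,
  so that it only takes few further steps for the \<open>L\<^sup>2\<close> contraction to equilibrate it.\<close>

lemma expectation_d_TV_le:
  "expectation (d_TV n A x0 (T + s)) \<le> binlt T hit m +
     1 / 2 * sqrt (real n * (contr ^ s * (1 / real k ^ m + real T * (pair_hit / real k))))"
proof -
  \<comment> \<open>\<open>z\<close> is the centred high mass and \<open>y\<close> the negative of
    the centred low mass, so \<open>z - y\<close> is the deviation from equilibrium. Centring makes
    the exact contraction available for \<open>z\<close>.\<close>
  define z where "z b x = high b T m x - (\<Sum>x\<in>{1..n}. high b T m x) / real n" for b x
  define y where "y b x = (\<Sum>x\<in>{1..n}. low b x0 T m x) / real n - low b x0 T m x" for b x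
  define Z where "Z \<omega> = (\<Sum>x\<in>{1..n}. \<bar>evolve (choices \<omega>) T s (z (choices \<omega>)) x\<bar>)" for \<omega>
  define Z2 where "Z2 \<omega> = (\<Sum>x\<in>{1..n}. (evolve (choices \<omega>) T s (z (choices \<omega>)) x)\<^sup>2)" for \<omega>
  have az: "adapted T z" unfolding z_def[abs_def] by (rule adapted_compose[OF adapted_high])
  have sz: "(\<Sum>x\<in>{1..n}. z b x) = 0" for b
    using n_pos by (simp add: z_def sum_subtractf del: One_nat_def)
  have intZ: "integrable M Z" unfolding Z_def[abs_def]
    by (rule adapted_integrable[where t = "T + s"]) (rule adapted_compose[OF adapted_evolve[OF az]])
  have intZsq: "integrable M (\<lambda>\<omega>. (Z \<omega>)\<^sup>2)" unfolding Z_def[abs_def]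
    by (rule adapted_integrable[where t = "T + s"]) (rule adapted_compose[OF adapted_evolve[OF az]])
  have intZ2: "integrable M Z2" unfolding Z2_def[abs_def]
    by (rule adapted_integrable[where t = "T + s"]) (rule adapted_compose[OF adapted_evolve[OF az]])
  have "d_TV n A x0 (T + s) \<omega> \<le> low_mass T m \<omega> + 1 / 2 * Z \<omega>" if "\<omega> \<in> space M" for \<omega>
  proof -
    let ?b = "choices \<omega>"
    note v = valid_choices[OF that]
    have "state ?b x0 T x - 1 / real n = z ?b x - y ?b x" for x
      unfolding z_def y_def sum_high_bounds(3)[OF v] by (simp add: diff_divide_distrib)
    then have "state ?b x0 (T + s) x - 1 / real n = evolve ?b T s (z ?b) x - evolve ?b T s (y ?b) x" for x
      unfolding evolve_add evolve_diff[symmetric] using evolve_centered[OF v, of T s "state ?b x0 T" "1 / real n" x] by simp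
    then have "d_TV n A x0 (T + s) \<omega> \<le> 1 / 2 * (\<Sum>x\<in>{1..n}. \<bar>evolve ?b T s (z ?b) x\<bar> + \<bar>evolve ?b T s (y ?b) x\<bar>)"
      unfolding d_TV_eq tv_norm_def by (intro mult_left_mono sum_mono) (simp_all add: abs_triangle_ineq4)
    also have "\<dots> \<le> 1 / 2 * Z \<omega> + 1 / 2 * (\<Sum>x\<in>{1..n}. \<bar>y ?b x\<bar>)"
      using sum_abs_evolve_le[OF v, of T s "y ?b"] by (simp add: Z_def sum.distrib)
    \<comment> \<open>The norm of \<open>y\<close> is at most twice the low mass, and the factor 1/2
      of total variation restores the constant 1. A larger constant would destroy the limit
      profile.\<close>
    also have "(\<Sum>x\<in>{1..n}. \<bar>y ?b x\<bar>) \<le> (\<Sum>x\<in>{1..n}. low_mass T m \<omega> / real n + low ?b x0 T m x)"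
    proof (rule sum_mono)
      fix x
      have "0 \<le> low_mass T m \<omega> / real n" "0 \<le> low ?b x0 T m x"
        using sum_low_bounds(1)[OF v x0, of T m] by (simp_all add: low_nonneg del: One_nat_def)
      then show "\<bar>y ?b x\<bar> \<le> low_mass T m \<omega> / real n + low ?b x0 T m x" unfolding y_def by linarith
    qed
    also have "\<dots> = 2 * low_mass T m \<omega>"
      using n_pos by (simp add: sum.distrib del: One_nat_def)
    finally show ?thesis by simp
  qed
  then have "expectation (d_TV n A x0 (T + s)) \<le> expectation (\<lambda>\<omega>. low_mass T m \<omega> + 1 / 2 * Z \<omega>)"
    using integrable_low_mass intZ
    by (intro integral_mono integrable_d_TV Bochner_Integration.integrable_add integrable_mult_right) auto
  also have "\<dots> = binlt T hit m + 1 / 2 * expectation Z"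
    using integrable_low_mass intZ by (simp add: expectation_low_mass[symmetric] del: One_nat_def)
  also have "expectation Z \<le> sqrt (expectation (\<lambda>\<omega>. (Z \<omega>)\<^sup>2))"
    using variance_eq[OF intZ intZsq] variance_positive[of Z] by (intro real_le_rsqrt) simp
  \<comment> \<open>The factor \<open>n\<close> from Cauchy-Schwarz is later compensated by
    \<open>k ^ m \<ge> n\<close> and \<open>pair_hit / k \<le> hit / n\<close>.\<close>
  also have "expectation (\<lambda>\<omega>. (Z \<omega>)\<^sup>2) \<le> expectation (\<lambda>\<omega>. real n * Z2 \<omega>)"
  proof (rule integral_mono)
    show "(Z \<omega>)\<^sup>2 \<le> real n * Z2 \<omega>" for \<omega>
      using Cauchy_Schwarz_ineq_sum[of "\<lambda>_. 1" "\<lambda>x. \<bar>evolve (choices \<omega>) T s (z (choices \<omega>)) x\<bar>" "{1..n}"]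
      by (simp add: Z_def Z2_def del: One_nat_def)
  qed (use intZsq intZ2 in auto)
  also have "\<dots> = real n * expectation Z2" by simp
  also have "expectation Z2 = contr ^ s * expectation (\<lambda>\<omega>. \<Sum>x\<in>{1..n}. (z (choices \<omega>) x)\<^sup>2)"
    unfolding Z2_def[abs_def] by (rule expectation_evolve_sq[OF az sz])
  also have "expectation (\<lambda>\<omega>. \<Sum>x\<in>{1..n}. (z (choices \<omega>) x)\<^sup>2) \<le>
      expectation (\<lambda>\<omega>. \<Sum>x\<in>{1..n}. (high (choices \<omega>) T m x)\<^sup>2)"
  proof (rule integral_mono)
    show "integrable M (\<lambda>\<omega>. \<Sum>x\<in>{1..n}. (z (choices \<omega>) x)\<^sup>2)"
      by (rule adapted_integrable[where t = T]) (rule adapted_compose[OF az])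
    show "integrable M (\<lambda>\<omega>. \<Sum>x\<in>{1..n}. (high (choices \<omega>) T m x)\<^sup>2)"
      by (rule adapted_integrable[where t = T]) (rule adapted_compose[OF adapted_high])
    fix \<omega>
    define c where "c = (\<Sum>x\<in>{1..n}. high (choices \<omega>) T m x) / real n"
    have "(\<Sum>x\<in>{1..n}. (z (choices \<omega>) x)\<^sup>2) =
      (\<Sum>x\<in>{1..n}. (high (choices \<omega>) T m x)\<^sup>2) - 2 * c * (\<Sum>x\<in>{1..n}. high (choices \<omega>) T m x) + real n * c\<^sup>2"
      unfolding z_def c_def[symmetric]
      by (rule sum_sq_shift)
    also have "(\<Sum>x\<in>{1..n}. high (choices \<omega>) T m x) = real n * c" using n_pos by (simp add: c_def)
    also have "(\<Sum>x\<in>{1..n}. (high (choices \<omega>) T m x)\<^sup>2) - 2 * c * (real n * c) + real n * c\<^sup>2 \<le> (\<Sum>x\<in>{1..n}. (high (choices \<omega>) T m x)\<^sup>2)"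
    proof -
      have "2 * c * (real n * c) = 2 * (real n * c\<^sup>2)" by (simp add: power2_eq_square)
      moreover have "0 \<le> real n * c\<^sup>2" by simp
      ultimately show ?thesis by linarith
    qed
    finally show "(\<Sum>x\<in>{1..n}. (z (choices \<omega>) x)\<^sup>2) \<le> (\<Sum>x\<in>{1..n}. (high (choices \<omega>) T m x)\<^sup>2)" .
  qed
  also have "\<dots> \<le> 1 / real k ^ m + real T * (pair_hit / real k)" by (rule expectation_high_sq)
  finally show ?thesis using hit_bounds(7) by (simp add: mult_left_mono)
qed

end

section \<open>The normal limit of the number of hits\<close>

lemma char_binomial:
  assumes p: "p \<in> {0..1}"
  shows "char (distr (measure_pmf (binomial_pmf t p)) borel (\<lambda>j. (real j - a) / c)) \<theta> =
    iexp (- (\<theta> / c * a)) * (1 - complex_of_real p + complex_of_real p * iexp (\<theta> / c)) ^ t"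
proof -
  let ?e = "iexp (\<theta> / c)"
  have "char (distr (measure_pmf (binomial_pmf t p)) borel (\<lambda>j. (real j - a) / c)) \<theta> =
      measure_pmf.expectation (binomial_pmf t p) (\<lambda>j. iexp (\<theta> * ((real j - a) / c)))"
    unfolding char_def by (subst integral_distr) auto
  also have "\<dots> = (\<Sum>j\<le>t. (real (t choose j) * p ^ j * (1 - p) ^ (t - j)) *\<^sub>R iexp (\<theta> * ((real j - a) / c)))"
    by (rule expectation_binomial_pmf'[OF p])
  also have "\<dots> = (\<Sum>j\<le>t. iexp (- (\<theta> / c * a)) *
      (of_nat (t choose j) * (complex_of_real p * ?e) ^ j * (1 - complex_of_real p) ^ (t - j)))"
  proof (rule sum.cong[OF refl])
    fix j
    have "iexp (\<theta> * ((real j - a) / c)) = iexp (- (\<theta> / c * a)) * ?e ^ j"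
      unfolding exp_of_nat_mult[symmetric] exp_add[symmetric]
      by (rule arg_cong[where f = exp]) (simp add: algebra_simps diff_divide_distrib)
    then show "(real (t choose j) * p ^ j * (1 - p) ^ (t - j)) *\<^sub>R iexp (\<theta> * ((real j - a) / c)) =
      iexp (- (\<theta> / c * a)) * (of_nat (t choose j) * (complex_of_real p * ?e) ^ j * (1 - complex_of_real p) ^ (t - j))"
      by (simp add: scaleR_conv_of_real power_mult_distrib mult_ac)
  qed
  also have "\<dots> = iexp (- (\<theta> / c * a)) * (complex_of_real p * ?e + (1 - complex_of_real p)) ^ t"
    unfolding binomial_ring sum_distrib_left ..
  finally show ?thesis by (simp add: algebra_simps)
qed

text \<open>The Poisson law with the same mean has an explicit characteristic exponent. A single
  factor differs from its Poisson counterpart by a second-order remainder of \<open>exp\<close>, and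
  both bases have norm at most 1, so the \<open>t\<close>-th powers differ by at most
  \<open>t\<close> times as much. The constant \<open>exp 2\<close> comes from the real part of
  \<open>w\<close> lying between -2 and 0.\<close>

lemma binomial_char_poisson_bound:
  assumes p: "p \<in> {0..1}"
  shows "norm ((1 - complex_of_real p + complex_of_real p * iexp \<alpha>) ^ t -
     exp (complex_of_real p * (iexp \<alpha> - 1)) ^ t) \<le> real t * (exp 2 * (p * \<bar>\<alpha>\<bar>)\<^sup>2)"
proof -
  define w where "w = complex_of_real p * (iexp \<alpha> - 1)"
  have "norm (iexp \<alpha> - 1) \<le> \<bar>\<alpha>\<bar>" using iexp_approx1[of \<alpha> 0] by simp
  then have w1: "norm w \<le> p * \<bar>\<alpha>\<bar>" using p by (simp add: w_def norm_mult mult_left_mono)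
  have Re: "Re w = p * (cos \<alpha> - 1)" by (simp add: w_def Re_exp)
  have Re1: "Re w \<le> 0" using p by (simp add: Re mult_le_0_iff)
  have "\<bar>Re w\<bar> = p * \<bar>cos \<alpha> - 1\<bar>" using p by (simp add: Re abs_mult)
  also have "\<dots> \<le> 1 * 2" using p cos_ge_minus_one[of \<alpha>] cos_le_one[of \<alpha>] by (intro mult_mono) auto
  finally have Re2: "\<bar>Re w\<bar> \<le> 2" by simp
  have "norm (exp w - (\<Sum>k\<le>1. w ^ k / fact k)) \<le> exp \<bar>Re w\<bar> * norm w ^ Suc 1 / fact 1"
    by (rule Taylor_exp)
  also have "\<dots> \<le> exp 2 * (p * \<bar>\<alpha>\<bar>)\<^sup>2"
    using w1 Re2 p by (simp add: numeral_2_eq_2[symmetric] mult_mono power_mono del: power_Suc)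
  finally have approx: "norm (1 + w - exp w) \<le> exp 2 * (p * \<bar>\<alpha>\<bar>)\<^sup>2"
    by (simp add: norm_minus_commute)
  have n1: "norm (1 + w) \<le> 1"
  proof -
    have "norm (1 + w) = norm (complex_of_real (1 - p) + complex_of_real p * iexp \<alpha>)"
      by (simp add: w_def algebra_simps)
    also have "\<dots> \<le> \<bar>1 - p\<bar> + \<bar>p\<bar>"
      by (rule order_trans[OF norm_triangle_ineq]) (simp add: norm_mult del: of_real_diff)
    finally show ?thesis using p by simp
  qed
  have n2: "norm (exp w) \<le> 1" using Re1 by simp
  have "norm ((1 + w) ^ t - exp w ^ t) \<le> real t * norm (1 + w - exp w)"
    using n1 n2 by (rule norm_power_diff)
  also have "\<dots> \<le> real t * (exp 2 * (p * \<bar>\<alpha>\<bar>)\<^sup>2)" using approx by (intro mult_left_mono) auto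
  finally show ?thesis by (simp add: w_def algebra_simps)
qed

abbreviation \<Phi> :: "real \<Rightarrow> real" where
  "\<Phi> \<equiv> cdf std_normal_distribution"

interpretation std_normal: real_distribution std_normal_distribution
  by (rule real_dist_normal_dist)

lemma isCont_\<Phi>: "isCont \<Phi> x"
proof -
  have "emeasure std_normal_distribution {x} = (\<integral>\<^sup>+ y. ennreal (std_normal_density y) * indicator {x} y \<partial>lborel)"
    by (subst emeasure_density) auto
  also have "\<dots> = (\<integral>\<^sup>+ y. 0 \<partial>(lborel :: real measure))"
  proof (rule nn_integral_cong_AE)
    show "AE y in lborel. ennreal (std_normal_density y) * indicator {x} y = 0"
      using AE_lborel_singleton[of x] by eventually_elim auto
  qed
  finally show ?thesis by (simp add: std_normal.isCont_cdf measure_def)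
qed

text \<open>The success probability varies with the index, so this is a limit theorem for a
  triangular array, obtained from Levy's continuity theorem. Scaling by \<open>sqrt (r n)\<close> in
  place of the standard deviation is harmless: the variance \<open>t p (1 - p)\<close> is asymptotic
  to \<open>r\<close>.\<close>

lemma weak_conv_binomial:
  fixes t :: "nat \<Rightarrow> nat" and p r :: "nat \<Rightarrow> real"
  assumes p01: "\<forall>\<^sub>F n in sequentially. p n \<in> {0..1}" and p0: "p \<longlonglongrightarrow> 0"
    and r: "filterlim r at_top sequentially"
    and tp: "(\<lambda>n. real (t n) * p n / r n) \<longlonglongrightarrow> 1"
  shows "weak_conv_m (\<lambda>n. distr (measure_pmf (binomial_pmf (t n) (p n))) borel
     (\<lambda>j. (real j - real (t n) * p n) / sqrt (r n))) std_normal_distribution"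
proof (rule levy_continuity)
  fix n
  show "real_distribution (distr (measure_pmf (binomial_pmf (t n) (p n))) borel
     (\<lambda>j. (real j - real (t n) * p n) / sqrt (r n)))"
    by (rule prob_space.real_distribution_distr[OF prob_space_measure_pmf]) simp
next
  show "real_distribution std_normal_distribution" by (rule real_dist_normal_dist)
next
  fix \<theta> :: real
  define l where "l n = real (t n) * p n" for n
  define \<alpha> where "\<alpha> n = \<theta> / sqrt (r n)" for n
  \<comment> \<open>The Taylor remainder after the quadratic term. It is of order
    \<open>r powr (-3/2)\<close>, and \<open>l\<close> is of order \<open>r\<close>, so their
    product vanishes.\<close>
  define u where "u n = iexp (\<alpha> n) - 1 - \<i> * \<alpha> n + (\<alpha> n)\<^sup>2 / 2" for n
  have rpos: "\<forall>\<^sub>F n in sequentially. 0 < r n" using r by (rule filterlim_at_top_dense[THEN iffD1, rule_format])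
  have sq0: "(\<lambda>n. 1 / sqrt (r n)) \<longlonglongrightarrow> 0"
    by (rule filterlim_compose[OF _ r]) real_asymp
  have "(\<lambda>n. complex_of_real (l n) * u n) \<longlonglongrightarrow> 0"
  proof (rule Lim_null_comparison)
    show "(\<lambda>n. (l n / r n) * (1 / sqrt (r n)) * (\<bar>\<theta>\<bar> ^ 3 / 6)) \<longlonglongrightarrow> 0"
      using tendsto_mult[OF tendsto_mult[OF tp sq0] tendsto_const[of "\<bar>\<theta>\<bar> ^ 3 / 6"]]
      unfolding l_def by (simp only: mult_zero_left mult_zero_right)
    show "\<forall>\<^sub>F n in sequentially. norm (complex_of_real (l n) * u n) \<le> (l n / r n) * (1 / sqrt (r n)) * (\<bar>\<theta>\<bar> ^ 3 / 6)"
      using rpos p01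
    proof eventually_elim
      case (elim n)
      have "u n = iexp (\<alpha> n) - (\<Sum>k \<le> 2. (\<i> * \<alpha> n) ^ k / fact k)"
        by (simp add: u_def numeral_2_eq_2 power_mult_distrib field_simps)
      then have "norm (u n) \<le> \<bar>\<alpha> n\<bar> ^ Suc 2 / fact (Suc 2)" using iexp_approx1[of "\<alpha> n" 2] by metis
      also have "\<dots> = \<bar>\<theta>\<bar> ^ 3 / (r n * sqrt (r n)) / 6"
        using elim(1) by (simp add: \<alpha>_def power_divide fact_numeral numeral_3_eq_3 abs_divide)
      finally have un: "norm (u n) \<le> \<bar>\<theta>\<bar> ^ 3 / (r n * sqrt (r n)) / 6" .
      have "0 \<le> l n" using elim(2) by (simp add: l_def)
      then have "norm (complex_of_real (l n) * u n) \<le> l n * (\<bar>\<theta>\<bar> ^ 3 / (r n * sqrt (r n)) / 6)"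
        using mult_left_mono[OF un] by (simp add: norm_mult)
      then show ?case by simp
    qed
  qed
  moreover have "(\<lambda>n. complex_of_real (- ((l n / r n) * \<theta>\<^sup>2 / 2))) \<longlonglongrightarrow> complex_of_real (- (1 * \<theta>\<^sup>2 / 2))"
    unfolding l_def by (intro tendsto_intros tp) simp
  ultimately have "(\<lambda>n. complex_of_real (l n) * u n + complex_of_real (- ((l n / r n) * \<theta>\<^sup>2 / 2))) \<longlonglongrightarrow>
     0 + complex_of_real (- (1 * \<theta>\<^sup>2 / 2))" by (rule tendsto_add)
  then have "(\<lambda>n. complex_of_real (l n) * u n + complex_of_real (- ((l n / r n) * \<theta>\<^sup>2 / 2))) \<longlonglongrightarrow>
     complex_of_real (- (\<theta>\<^sup>2 / 2))" by simp
  then have "(\<lambda>n. complex_of_real (l n) * (iexp (\<alpha> n) - 1 - \<i> * \<alpha> n)) \<longlonglongrightarrow> complex_of_real (- (\<theta>\<^sup>2 / 2))"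
  proof (rule Lim_transform_eventually)
    show "\<forall>\<^sub>F n in sequentially. complex_of_real (l n) * u n + complex_of_real (- ((l n / r n) * \<theta>\<^sup>2 / 2)) =
        complex_of_real (l n) * (iexp (\<alpha> n) - 1 - \<i> * \<alpha> n)"
      using rpos
    proof eventually_elim
      case (elim n)
      have "complex_of_real ((\<alpha> n)\<^sup>2) = complex_of_real (\<theta>\<^sup>2 / r n)"
        using elim by (simp only: \<alpha>_def power_divide real_sqrt_pow2 less_imp_le)
      then have "iexp (\<alpha> n) - 1 - \<i> * \<alpha> n = u n - complex_of_real (\<theta>\<^sup>2 / r n) / 2"
        unfolding u_def by simp
      then show ?case by (simp add: right_diff_distrib)
    qed
  qed
  from tendsto_exp[OF this]
  have main: "(\<lambda>n. exp (complex_of_real (l n) * (iexp (\<alpha> n) - 1 - \<i> * \<alpha> n))) \<longlonglongrightarrow> complex_of_real (exp (- (\<theta>\<^sup>2) / 2))"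
    by (simp add: exp_of_real[symmetric])
  \<comment> \<open>The Poisson comparison costs a constant times
    \<open>(l / r) p \<theta>\<^sup>2\<close>, which tends to 0 with \<open>p\<close>.\<close>
  have diff: "(\<lambda>n. char (distr (measure_pmf (binomial_pmf (t n) (p n))) borel
     (\<lambda>j. (real j - real (t n) * p n) / sqrt (r n))) \<theta> -
      exp (complex_of_real (l n) * (iexp (\<alpha> n) - 1 - \<i> * \<alpha> n))) \<longlonglongrightarrow> 0"
  proof (rule Lim_null_comparison)
    show "(\<lambda>n. exp 2 * (l n / r n) * p n * \<theta>\<^sup>2) \<longlonglongrightarrow> 0"
    proof -
      have "(\<lambda>n. exp 2 * (l n / r n) * p n * \<theta>\<^sup>2) \<longlonglongrightarrow> exp 2 * 1 * 0 * \<theta>\<^sup>2"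
        unfolding l_def by (intro tendsto_intros tp p0)
      then show ?thesis by simp
    qed
    show "\<forall>\<^sub>F n in sequentially. norm (char (distr (measure_pmf (binomial_pmf (t n) (p n))) borel
     (\<lambda>j. (real j - real (t n) * p n) / sqrt (r n))) \<theta> -
      exp (complex_of_real (l n) * (iexp (\<alpha> n) - 1 - \<i> * \<alpha> n))) \<le> exp 2 * (l n / r n) * p n * \<theta>\<^sup>2"
      using rpos p01
    proof eventually_elim
      case (elim n)
      let ?P = "complex_of_real (p n)"
      have 1: "exp (complex_of_real (l n) * (iexp (\<alpha> n) - 1 - \<i> * \<alpha> n)) =
        iexp (- (\<alpha> n * l n)) * exp (?P * (iexp (\<alpha> n) - 1)) ^ t n"
        unfolding exp_of_nat_mult[symmetric] exp_add[symmetric]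
        by (rule arg_cong[where f = exp]) (simp add: l_def algebra_simps)
      have "norm (iexp (- (\<alpha> n * l n)) * (1 - ?P + ?P * iexp (\<alpha> n)) ^ t n -
          iexp (- (\<alpha> n * l n)) * exp (?P * (iexp (\<alpha> n) - 1)) ^ t n) =
         norm ((1 - ?P + ?P * iexp (\<alpha> n)) ^ t n - exp (?P * (iexp (\<alpha> n) - 1)) ^ t n)"
        unfolding right_diff_distrib[symmetric] norm_mult norm_exp_i_times by simp
      also have "\<dots> \<le> real (t n) * (exp 2 * (p n * \<bar>\<alpha> n\<bar>)\<^sup>2)"
        by (rule binomial_char_poisson_bound[OF elim(2)])
      also have "\<dots> = exp 2 * (l n / r n) * p n * \<theta>\<^sup>2"
        using elim(1) by (simp add: \<alpha>_def l_def power_mult_distrib power_divide power2_eq_square[of "p n"])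
      finally show ?case
        unfolding char_binomial[OF elim(2)] 1 \<alpha>_def[symmetric] l_def[symmetric] .
    qed
  qed
  from tendsto_add[OF diff main]
  show "(\<lambda>n. char (distr (measure_pmf (binomial_pmf (t n) (p n))) borel
     (\<lambda>j. (real j - real (t n) * p n) / sqrt (r n))) \<theta>) \<longlonglongrightarrow> char std_normal_distribution \<theta>"
    by (simp add: char_std_normal_distribution)
qed

text \<open>The threshold \<open>m\<close> is within \<open>o(sqrt r)\<close> of \<open>r\<close>,
  so the standardised threshold \<open>a\<close> tends to \<open>- \<beta>\<close>. As it moves with
  the index, the tail is squeezed between distribution functions at two fixed points around
  \<open>- \<beta>\<close>, and continuity of \<Phi> closes the gap.\<close>

lemma binlt_tendsto:
  fixes t m :: "nat \<Rightarrow> nat" and p r :: "nat \<Rightarrow> real"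
  assumes p01: "\<forall>\<^sub>F n in sequentially. p n \<in> {0..1}" and p0: "p \<longlonglongrightarrow> 0"
    and r: "filterlim r at_top sequentially"
    and t: "(\<lambda>n. (real (t n) * p n - r n) / sqrt (r n)) \<longlonglongrightarrow> \<beta>"
    and m: "(\<lambda>n. (real (m n) - r n) / sqrt (r n)) \<longlonglongrightarrow> 0"
  shows "(\<lambda>n. binlt (t n) (p n) (m n)) \<longlonglongrightarrow> \<Phi> (- \<beta>)"
proof -
  define X where "X n = distr (measure_pmf (binomial_pmf (t n) (p n))) borel
     (\<lambda>j. (real j - real (t n) * p n) / sqrt (r n))" for n
  define a where "a n = (real (m n) - real (t n) * p n) / sqrt (r n)" for n
  have rpos: "\<forall>\<^sub>F n in sequentially. 0 < r n" using r by (rule filterlim_at_top_dense[THEN iffD1, rule_format])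
  have sq0: "(\<lambda>n. 1 / sqrt (r n)) \<longlonglongrightarrow> 0"
    by (rule filterlim_compose[OF _ r]) real_asymp
  have "(\<lambda>n. 1 + (real (t n) * p n - r n) / sqrt (r n) * (1 / sqrt (r n))) \<longlonglongrightarrow> 1 + \<beta> * 0"
    by (intro tendsto_intros t sq0)
  moreover have "\<forall>\<^sub>F n in sequentially. 1 + (real (t n) * p n - r n) / sqrt (r n) * (1 / sqrt (r n)) = real (t n) * p n / r n"
    using rpos by eventually_elim (simp add: field_simps)
  ultimately have tp: "(\<lambda>n. real (t n) * p n / r n) \<longlonglongrightarrow> 1"
    by (simp add: Lim_transform_eventually)
  have conv: "(\<lambda>n. cdf (X n) x) \<longlonglongrightarrow> \<Phi> x" for x
    using weak_conv_binomial[OF p01 p0 r tp] isCont_\<Phi> unfolding weak_conv_m_def weak_conv_def X_def by blast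
  have "(\<lambda>n. (real (m n) - r n) / sqrt (r n) - (real (t n) * p n - r n) / sqrt (r n)) \<longlonglongrightarrow> 0 - \<beta>"
    by (intro tendsto_intros t m)
  then have a: "a \<longlonglongrightarrow> - \<beta>" by (simp add: a_def[abs_def] diff_divide_distrib[symmetric])
  have cdfX: "cdf (X n) x = measure_pmf.prob (binomial_pmf (t n) (p n)) {j. (real j - real (t n) * p n) / sqrt (r n) \<le> x}" for n x
    unfolding X_def cdf_def by (subst measure_distr) (auto intro!: arg_cong2[where f = measure])
  show ?thesis
  proof (rule tendstoI)
    fix e :: real assume "0 < e"
    then have "\<forall>\<^sub>F x in at (- \<beta>). dist (\<Phi> x) (\<Phi> (- \<beta>)) < e / 2"
      using isCont_\<Phi>[of "- \<beta>"] unfolding isCont_def by (intro tendstoD) auto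
    then obtain d where d: "0 < d" "\<And>x. x \<noteq> - \<beta> \<Longrightarrow> dist x (- \<beta>) < d \<Longrightarrow> dist (\<Phi> x) (\<Phi> (- \<beta>)) < e / 2"
      unfolding eventually_at by auto
    define d' where "d' = d / 2"
    have d': "0 < d'" "\<bar>\<Phi> (- \<beta> - d') - \<Phi> (- \<beta>)\<bar> < e / 2" "\<bar>\<Phi> (- \<beta> + d') - \<Phi> (- \<beta>)\<bar> < e / 2"
      using d(1) d(2)[of "- \<beta> - d'"] d(2)[of "- \<beta> + d'"] by (auto simp: d'_def dist_real_def)
    have "\<forall>\<^sub>F n in sequentially. \<bar>a n - (- \<beta>)\<bar> < d'"
      using tendstoD[OF a d'(1)] by (simp add: dist_real_def)
    moreover have "\<forall>\<^sub>F n in sequentially. \<bar>cdf (X n) (- \<beta> - d') - \<Phi> (- \<beta> - d')\<bar> < e / 2"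
      "\<forall>\<^sub>F n in sequentially. \<bar>cdf (X n) (- \<beta> + d') - \<Phi> (- \<beta> + d')\<bar> < e / 2"
      using tendstoD[OF conv, of "e / 2"] \<open>0 < e\<close> by (simp_all add: dist_real_def)
    ultimately show "\<forall>\<^sub>F n in sequentially. dist (binlt (t n) (p n) (m n)) (\<Phi> (- \<beta>)) < e"
      using rpos
    proof eventually_elim
      case (elim n)
      have lt: "j < m n \<longleftrightarrow> (real j - real (t n) * p n) / sqrt (r n) < a n" for j
        using elim(4) by (simp add: a_def divide_less_cancel)
      have "cdf (X n) (- \<beta> - d') \<le> binlt (t n) (p n) (m n)"
        unfolding cdfX binlt_def using elim(1) by (intro measure_pmf.finite_measure_mono) (auto simp: lt)
      moreover have "binlt (t n) (p n) (m n) \<le> cdf (X n) (- \<beta> + d')"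
        unfolding cdfX binlt_def using elim(1) by (intro measure_pmf.finite_measure_mono) (auto simp: lt)
      ultimately show ?case using elim d' unfolding dist_real_def by linarith
    qed
  qed
qed

section \<open>Mean absolute deviation of the distance from a constant, for fixed n\<close>

context block_average
begin

lemma contr_power_le: "contr ^ s \<le> exp (- (hit * real s) / 2)"
proof -
  have "contr \<le> exp (- hit / 2)"
    using hit_bounds(8) exp_ge_add_one_self[of "- hit / 2"] by linarith
  then have "contr ^ s \<le> exp (- hit / 2) ^ s" using hit_bounds(7) by (intro power_mono)
  also have "\<dots> = exp (- (hit * real s) / 2)"
    unfolding exp_of_nat_mult[symmetric] by (simp add: mult.commute)
  finally show ?thesis .
qed

text \<open>The coincidence probability is at most its equilibrium value \<open>1 / n\<close> plus
  an excess \<open>contr ^ t\<close>. Since \<open>1 - contr \<ge> hit / 2\<close>, the geometric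
  series of the excess sums to at most \<open>2 / hit\<close>, and the waiting time \<open>s\<close>
  gives it an exponentially small prefactor.\<close>

lemma hit_sum_state_sq_le:
  "hit * (\<Sum>v<u. state_sq (s + v)) \<le> hit * real u / real n + 2 * exp (- (hit * real s) / 2)"
proof -
  have geo: "hit * (\<Sum>v<u. contr ^ v) \<le> 2"
  proof -
    have "(1 - contr) * (\<Sum>v<u. contr ^ v) = 1 - contr ^ u"
      by (simp add: one_diff_power_eq)
    moreover have "hit / 2 * (\<Sum>v<u. contr ^ v) \<le> (1 - contr) * (\<Sum>v<u. contr ^ v)"
      using hit_bounds(7,8) by (intro mult_right_mono sum_nonneg) auto
    moreover have "0 \<le> contr ^ u" using hit_bounds(7) by simp
    ultimately show ?thesis by simp
  qed
  have "hit * (\<Sum>v<u. state_sq (s + v)) \<le> hit * (\<Sum>v<u. 1 / real n + contr ^ (s + v))"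
    using hit_bounds(1) state_sq_le by (intro mult_left_mono sum_mono) auto
  also have "\<dots> = hit * real u / real n + contr ^ s * (hit * (\<Sum>v<u. contr ^ v))"
    by (simp add: sum.distrib power_add sum_distrib_left algebra_simps)
  also have "\<dots> \<le> hit * real u / real n + exp (- (hit * real s) / 2) * 2"
    using hit_bounds(1,7) contr_power_le geo by (intro add_left_mono mult_mono) (auto intro!: mult_nonneg_nonneg sum_nonneg)
  finally show ?thesis by simp
qed

lemma expectation_abs_le_sqrt:
  assumes "integrable M f" "integrable M (\<lambda>\<omega>. (f \<omega>)\<^sup>2)"
  shows "expectation (\<lambda>\<omega>. \<bar>f \<omega>\<bar> :: real) \<le> sqrt (expectation (\<lambda>\<omega>. (f \<omega>)\<^sup>2))"
  using variance_eq[of "\<lambda>\<omega>. \<bar>f \<omega>\<bar>"] variance_positive[of "\<lambda>\<omega>. \<bar>f \<omega>\<bar>"] assms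
  by (intro real_le_rsqrt) simp

text \<open>Expanding the square about \<open>\<phi>\<close> takes the exact mean and an upper bound
  on the second moment. When both tails tend to \<open>\<phi>\<close> and the error vanishes, the
  radicand tends to \<open>\<phi>\<^sup>2 - 2 \<phi>\<^sup>2 + \<phi>\<^sup>2 = 0\<close>.\<close>

lemma expectation_abs_low_mass_le:
  "expectation (\<lambda>\<omega>. \<bar>low_mass (s + u) m \<omega> - \<phi>\<bar>) \<le>
    sqrt ((binlt u hit m)\<^sup>2 + (hit * real u / real n + 2 * exp (- (hit * real s) / 2))
      - 2 * \<phi> * binlt (s + u) hit m + \<phi>\<^sup>2)"
proof -
  let ?G = "low_mass (s + u) m"
  note int = integrable_low_mass[of "s + u" m] integrable_low_mass2[of "s + u" m m]
  have sq: "(?G \<omega> - \<phi>)\<^sup>2 = ?G \<omega> * ?G \<omega> - 2 * \<phi> * ?G \<omega> + \<phi>\<^sup>2" for \<omega>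
    by (simp add: power2_eq_square algebra_simps)
  have i1: "integrable M (\<lambda>\<omega>. ?G \<omega> - \<phi>)" using int by (simp del: One_nat_def)
  have i2: "integrable M (\<lambda>\<omega>. (?G \<omega> - \<phi>)\<^sup>2)" unfolding sq
    by (intro Bochner_Integration.integrable_add Bochner_Integration.integrable_diff integrable_mult_right int integrable_const)
  have "expectation (\<lambda>\<omega>. (?G \<omega> - \<phi>)\<^sup>2) =
      expectation (\<lambda>\<omega>. ?G \<omega> * ?G \<omega>) - 2 * \<phi> * binlt (s + u) hit m + \<phi>\<^sup>2"
    unfolding sq using int by (simp add: prob_space expectation_low_mass[symmetric] del: One_nat_def)
  also have "\<dots> \<le> (binlt u hit m)\<^sup>2 + (hit * real u / real n + 2 * exp (- (hit * real s) / 2))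
      - 2 * \<phi> * binlt (s + u) hit m + \<phi>\<^sup>2"
    using expectation_low_mass_product[of s u m m] hit_sum_state_sq_le[of s u]
    by (simp add: power2_eq_square[of "binlt u hit m"])
  finally show ?thesis
    using expectation_abs_le_sqrt[OF i1 i2] by (meson order_trans real_sqrt_le_mono)
qed

text \<open>On every realisation the distance dominates the low mass up to
  \<open>k ^ ml / n\<close>, so the mean absolute difference of the two is controlled by the
  difference of their means. Concentration of the low mass thus passes to the distance. The
  threshold \<open>ml\<close> serves the lower bound, \<open>mh\<close> the upper one.\<close>

lemma expectation_abs_d_TV_le:
  assumes mh: "real n \<le> real k ^ mh"
  shows "expectation (\<lambda>\<omega>. \<bar>d_TV n A x0 (s + u) \<omega> - \<phi>\<bar>) \<le>
    binlt u hit mh + 1 / 2 * sqrt (exp (- (hit * real s) / 2) * (1 + real u * hit))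
      - binlt (s + u) hit ml + 2 * (real k ^ ml / real n) +
    sqrt ((binlt u hit ml)\<^sup>2 + (hit * real u / real n + 2 * exp (- (hit * real s) / 2))
      - 2 * \<phi> * binlt (s + u) hit ml + \<phi>\<^sup>2)"
proof -
  let ?G = "low_mass (s + u) ml" and ?d = "d_TV n A x0 (s + u)" and ?e = "real k ^ ml / real n"
  note int = integrable_low_mass[of "s + u" ml] integrable_d_TV[of "s + u"]
  have "expectation (\<lambda>\<omega>. \<bar>?d \<omega> - \<phi>\<bar>) \<le> expectation (\<lambda>\<omega>. ?d \<omega> - ?G \<omega> + 2 * ?e + \<bar>?G \<omega> - \<phi>\<bar>)"
  proof (rule integral_mono)
    fix \<omega> assume "\<omega> \<in> space M"
    from d_TV_ge[OF this, of "s + u" ml]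
    have "0 \<le> ?d \<omega> - ?G \<omega> + ?e" by simp
    moreover have "0 \<le> ?e" by simp
    ultimately show "\<bar>?d \<omega> - \<phi>\<bar> \<le> ?d \<omega> - ?G \<omega> + 2 * ?e + \<bar>?G \<omega> - \<phi>\<bar>" by linarith
  qed (use int in \<open>auto simp del: One_nat_def\<close>)
  also have "\<dots> = expectation ?d - binlt (s + u) hit ml + 2 * ?e + expectation (\<lambda>\<omega>. \<bar>?G \<omega> - \<phi>\<bar>)"
    using int by (simp add: prob_space expectation_low_mass[symmetric] del: One_nat_def)
  also have "expectation ?d \<le> binlt u hit mh + 1 / 2 * sqrt (exp (- (hit * real s) / 2) * (1 + real u * hit))"
  proof -
    have "real n * (contr ^ s * (1 / real k ^ mh + real u * (pair_hit / real k))) =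
      contr ^ s * (real n / real k ^ mh + real u * (real n * (pair_hit / real k)))"
      by (simp add: algebra_simps)
    also have "\<dots> \<le> exp (- (hit * real s) / 2) * (1 + real u * hit)"
    proof (intro mult_mono contr_power_le add_mono mult_left_mono)
      show "real n / real k ^ mh \<le> 1" using mh k2 by simp
      have "real n * (pair_hit / real k) \<le> real n * (hit / real n)"
        by (rule mult_left_mono[OF hit_bounds(6)]) simp
      then show "real n * (pair_hit / real k) \<le> hit" using n_pos by simp
    qed (use hit_bounds(3) in auto)
    finally have "sqrt (real n * (contr ^ s * (1 / real k ^ mh + real u * (pair_hit / real k)))) \<le>
        sqrt (exp (- (hit * real s) / 2) * (1 + real u * hit))" by (rule real_sqrt_le_mono)
    then show ?thesis using expectation_d_TV_le[of u s mh] unfolding add.commute[of s u] by linarith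
  qed
  also have "expectation (\<lambda>\<omega>. \<bar>?G \<omega> - \<phi>\<bar>) \<le>
    sqrt ((binlt u hit ml)\<^sup>2 + (hit * real u / real n + 2 * exp (- (hit * real s) / 2))
      - 2 * \<phi> * binlt (s + u) hit ml + \<phi>\<^sup>2)"
    by (rule expectation_abs_low_mass_le)
  finally show ?thesis by simp
qed

end

text \<open>Otherwise an interval just above \<open>x\<close> would be null although the density is
  positive there. Strictness is what the converse direction plays against a process that has not
  moved.\<close>

lemma \<Phi>_less_1: "\<Phi> x < 1"
proof (rule ccontr)
  assume "\<not> \<Phi> x < 1"
  then have "\<Phi> x = 1" using std_normal.cdf_bounded_prob[of x] by linarith
  then have "std_normal.prob {..x} = 1" by (simp add: cdf_def)
  then have "AE y in std_normal_distribution. y \<in> {..x}"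
    by (subst std_normal.prob_eq_1[symmetric]) auto
  then have "AE y in lborel. y \<le> x"
    by (subst (asm) AE_density) (auto simp: normal_density_pos)
  then have "AE y in lborel. y \<notin> {x<..x + 1}" by eventually_elim auto
  then have "emeasure lborel {x<..x + 1} = 0"
    by (subst (asm) AE_iff_measurable[of "{x<..x + 1}"]) auto
  then show False by simp
qed

section \<open>Cutoff along a sequence of block sizes\<close>

lemma nat_floor_scaled:
  fixes x p :: real
  assumes "0 \<le> x" "0 < p"
  shows "p * real (nat \<lfloor>x / p\<rfloor>) \<le> x" "x - p \<le> p * real (nat \<lfloor>x / p\<rfloor>)"
proof -
  have eq: "real (nat \<lfloor>x / p\<rfloor>) = of_int \<lfloor>x / p\<rfloor>" using assms by simp
  have "p * of_int \<lfloor>x / p\<rfloor> \<le> p * (x / p)" using assms by (intro mult_left_mono) simp_all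
  then show "p * real (nat \<lfloor>x / p\<rfloor>) \<le> x" unfolding eq using assms by simp
  have "p * (x / p - 1) \<le> p * of_int \<lfloor>x / p\<rfloor>" using assms by (intro mult_left_mono) linarith+
  then show "x - p \<le> p * real (nat \<lfloor>x / p\<rfloor>)" unfolding eq using assms by (simp add: right_diff_distrib)
qed

lemma tendsto_of_abs_diff_le:
  fixes f g :: "nat \<Rightarrow> real"
  assumes "\<forall>\<^sub>F n in sequentially. \<bar>f n - c\<bar> \<le> g n" "g \<longlonglongrightarrow> 0"
  shows "f \<longlonglongrightarrow> c"
  using Lim_null_comparison[of "\<lambda>n. f n - c" g] assms by (simp add: LIM_zero_iff)

locale block_average_seq =
  fixes k x0 :: "nat \<Rightarrow> nat"
    and M :: "nat \<Rightarrow> 'w measure"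
    and A :: "nat \<Rightarrow> nat \<Rightarrow> 'w \<Rightarrow> nat set"
  assumes avg: "\<And>n. 2 \<le> n \<Longrightarrow> block_average (M n) n (k n) (A n) (x0 n)"
    and log_ratio: "(\<lambda>n. ln (real (k n)) / ln (real n)) \<longlonglongrightarrow> 0"
begin

definition r :: "nat \<Rightarrow> real" where "r n = ln (real n) / ln (real (k n))"

definition p :: "nat \<Rightarrow> real" where "p n = real (k n) / real n"

abbreviation time :: "real \<Rightarrow> nat \<Rightarrow> nat" where
  "time \<beta> n \<equiv> nat \<lfloor>t_ent n (k n) + \<beta> * t_w n (k n)\<rfloor>"

text \<open>A waiting time worth \<open>r powr (1/4)\<close> expected hits: exponentially small
  factors in it beat every power of \<open>r\<close>, yet shortening a run by it is invisible on the
  scale \<open>sqrt r\<close>.\<close>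

definition gap :: "nat \<Rightarrow> nat" where "gap n = nat \<lfloor>sqrt (sqrt (r n)) / p n\<rfloor>"

text \<open>The offset gains a factor \<open>k powr - (r powr (1/4))\<close>, so
  \<open>k ^ m_low\<close> is negligible against \<open>n\<close> even when \<open>k\<close> stays
  bounded.\<close>

definition m_low :: "nat \<Rightarrow> nat" where "m_low n = nat \<lfloor>r n - sqrt (sqrt (r n))\<rfloor>"

definition m_high :: "nat \<Rightarrow> nat" where "m_high n = nat \<lceil>r n\<rceil>"

lemma k_bounds: "2 \<le> n \<Longrightarrow> 2 \<le> k n" "2 \<le> n \<Longrightarrow> k n \<le> n"
proof -
  assume "2 \<le> n"
  then interpret block_average "M n" n "k n" "A n" "x0 n" by (rule avg)
  show "2 \<le> k n" "k n \<le> n" using k2 kn .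
qed

lemma hit_eq: "2 \<le> n \<Longrightarrow> block_size.hit n (k n) = p n"
  using k_bounds block_size.hit_def[of n "k n"] by (simp add: block_size_def p_def)

lemma ln_pos: "2 \<le> n \<Longrightarrow> 0 < ln (real n)" "2 \<le> n \<Longrightarrow> 0 < ln (real (k n))"
  "2 \<le> n \<Longrightarrow> ln 2 \<le> ln (real (k n))"
  using k_bounds[of n] by auto

lemma p_bounds: "2 \<le> n \<Longrightarrow> 0 < p n" "2 \<le> n \<Longrightarrow> p n \<le> 1"
  using k_bounds[of n] by (auto simp: p_def)

lemma p_mem: "\<forall>\<^sub>F n in sequentially. p n \<in> {0..1}"
  using eventually_ge_at_top[of 2] by eventually_elim (simp add: p_bounds less_imp_le)

lemma t_ent_eq: "2 \<le> n \<Longrightarrow> t_ent n (k n) = r n / p n"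
  by (simp add: t_ent_def r_def p_def mult.commute)

lemma t_w_eq: "2 \<le> n \<Longrightarrow> t_w n (k n) = sqrt (r n) / p n"
  by (simp add: t_w_def r_def p_def real_sqrt_divide mult.commute)

lemma r_at_top: "filterlim r at_top sequentially"
proof -
  have "\<forall>\<^sub>F n in sequentially. 0 < ln (real (k n)) / ln (real n)"
    using eventually_ge_at_top[of 2] by eventually_elim (simp add: ln_pos)
  from filterlim_inverse_at_top[OF log_ratio this]
  show ?thesis by (simp add: r_def[abs_def])
qed

lemma r_compose: "(f \<longlongrightarrow> c) at_top \<Longrightarrow> (\<lambda>n. f (r n)) \<longlonglongrightarrow> c"
  by (rule filterlim_compose[OF _ r_at_top])

lemma r_eventually: "eventually P at_top \<Longrightarrow> \<forall>\<^sub>F n in sequentially. P (r n)"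
  by (rule eventually_compose_filterlim[OF _ r_at_top])

text \<open>In the form \<open>p = n powr (ln k / ln n - 1)\<close> the exponent tends to
  -1.\<close>

lemma p_tendsto_0: "p \<longlonglongrightarrow> 0"
proof -
  have "filterlim (\<lambda>n. (1 - ln (real (k n)) / ln (real n)) * ln (real n)) at_top sequentially"
  proof (rule filterlim_tendsto_pos_mult_at_top)
    show "(\<lambda>n. 1 - ln (real (k n)) / ln (real n)) \<longlonglongrightarrow> 1 - 0"
      by (intro tendsto_intros log_ratio)
    show "filterlim (\<lambda>n. ln (real n)) at_top sequentially" by real_asymp
  qed simp
  moreover have "((\<lambda>x::real. exp (- x)) \<longlongrightarrow> 0) at_top" by real_asymp
  ultimately have "(\<lambda>n. exp (- ((1 - ln (real (k n)) / ln (real n)) * ln (real n)))) \<longlonglongrightarrow> 0"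
    by (rule filterlim_compose[rotated])
  moreover have "\<forall>\<^sub>F n in sequentially. exp (- ((1 - ln (real (k n)) / ln (real n)) * ln (real n))) = p n"
    using eventually_ge_at_top[of 2]
  proof eventually_elim
    case (elim n)
    have "- ((1 - ln (real (k n)) / ln (real n)) * ln (real n)) = ln (real (k n)) - ln (real n)"
      using ln_pos[OF elim] by (simp add: field_simps)
    then show ?case using elim k_bounds[OF elim] by (simp add: exp_diff p_def)
  qed
  ultimately show ?thesis by (rule Lim_transform_eventually)
qed

lemma r_over_n: "(\<lambda>n. r n / real n) \<longlonglongrightarrow> 0"
proof (rule tendsto_of_abs_diff_le)
  show "(\<lambda>n. ln (real n) / (ln 2 * real n)) \<longlonglongrightarrow> 0" by real_asymp
  show "\<forall>\<^sub>F n in sequentially. \<bar>r n / real n - 0\<bar> \<le> ln (real n) / (ln 2 * real n)"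
    using eventually_ge_at_top[of 2]
  proof eventually_elim
    case (elim n)
    have "r n \<le> ln (real n) / ln 2"
      unfolding r_def using ln_pos[OF elim] by (intro divide_left_mono) auto
    moreover have "0 \<le> r n" using ln_pos[OF elim] by (simp add: r_def)
    ultimately show ?case using elim divide_right_mono[of "r n" "ln (real n) / ln 2" "real n"] by simp
  qed
qed

lemma time_eq: "2 \<le> n \<Longrightarrow> time \<beta> n = nat \<lfloor>(r n + \<beta> * sqrt (r n)) / p n\<rfloor>"
  by (simp add: t_ent_eq t_w_eq add_divide_distrib)

lemma eventually_large:
  "\<forall>\<^sub>F n in sequentially. 2 \<le> n \<and> 1 \<le> r n \<and> sqrt (sqrt (r n)) \<le> r n \<and> 0 \<le> sqrt (sqrt (r n)) \<and>
     sqrt (sqrt (r n)) \<le> r n + \<beta> * sqrt (r n)"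
proof -
  have "\<forall>\<^sub>F x :: real in at_top. 1 \<le> x \<and> sqrt (sqrt x) \<le> x \<and> 0 \<le> sqrt (sqrt x)"
    by (intro eventually_conj; real_asymp)
  moreover have "\<forall>\<^sub>F x in at_top. sqrt (sqrt x) \<le> x + \<beta> * sqrt x"
    by real_asymp
  ultimately have "\<forall>\<^sub>F x in at_top. (1 \<le> x \<and> sqrt (sqrt x) \<le> x \<and> 0 \<le> sqrt (sqrt x)) \<and> sqrt (sqrt x) \<le> x + \<beta> * sqrt x"
    by (rule eventually_conj)
  from r_eventually[OF this] eventually_ge_at_top[of 2]
  show ?thesis by eventually_elim auto
qed

text \<open>Multiplying by \<open>p\<close> measures times in expected hits; rounding then costs at
  most \<open>p \<le> 1\<close>.\<close>

lemma eventually_time: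
  "\<forall>\<^sub>F n in sequentially. gap n \<le> time \<beta> n \<and>
     \<bar>p n * real (time \<beta> n) - (r n + \<beta> * sqrt (r n))\<bar> \<le> 1 \<and>
     \<bar>p n * real (gap n) - sqrt (sqrt (r n))\<bar> \<le> 1"
  using eventually_large[of \<beta>]
proof eventually_elim
  case (elim n)
  then have n: "2 \<le> n" by simp
  have h: "0 \<le> sqrt (sqrt (r n))" "0 \<le> r n + \<beta> * sqrt (r n)" using elim by linarith+
  have "gap n \<le> time \<beta> n"
    unfolding gap_def time_eq[OF n] using elim p_bounds[OF n]
    by (intro nat_mono floor_mono divide_right_mono) auto
  moreover have "\<bar>p n * real (time \<beta> n) - (r n + \<beta> * sqrt (r n))\<bar> \<le> 1"
    unfolding time_eq[OF n] using nat_floor_scaled[OF h(2) p_bounds(1)[OF n]] p_bounds[OF n] by linarith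
  moreover have "\<bar>p n * real (gap n) - sqrt (sqrt (r n))\<bar> \<le> 1"
    unfolding gap_def using nat_floor_scaled[OF h(1) p_bounds(1)[OF n]] p_bounds[OF n] by linarith
  ultimately show ?case by blast
qed

lemma time_fluctuation: "(\<lambda>n. (real (time \<beta> n) * p n - r n) / sqrt (r n)) \<longlonglongrightarrow> \<beta>"
proof (rule tendsto_of_abs_diff_le)
  show "(\<lambda>n. 1 / sqrt (r n)) \<longlonglongrightarrow> 0" by (rule r_compose) real_asymp
  show "\<forall>\<^sub>F n in sequentially. \<bar>(real (time \<beta> n) * p n - r n) / sqrt (r n) - \<beta>\<bar> \<le> 1 / sqrt (r n)"
    using eventually_time[of \<beta>] eventually_large[of \<beta>]
  proof eventually_elim
    case (elim n)
    then have "0 < sqrt (r n)" by simp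
    then have "(real (time \<beta> n) * p n - r n) / sqrt (r n) - \<beta> =
        (p n * real (time \<beta> n) - (r n + \<beta> * sqrt (r n))) / sqrt (r n)"
      by (simp add: field_simps)
    then show ?case using elim by (simp add: abs_divide divide_right_mono)
  qed
qed

lemma time_minus_gap_fluctuation:
  "(\<lambda>n. (real (time \<beta> n - gap n) * p n - r n) / sqrt (r n)) \<longlonglongrightarrow> \<beta>"
proof (rule tendsto_of_abs_diff_le)
  show "(\<lambda>n. (2 + sqrt (sqrt (r n))) / sqrt (r n)) \<longlonglongrightarrow> 0" by (rule r_compose) real_asymp
  show "\<forall>\<^sub>F n in sequentially. \<bar>(real (time \<beta> n - gap n) * p n - r n) / sqrt (r n) - \<beta>\<bar> \<le>
      (2 + sqrt (sqrt (r n))) / sqrt (r n)"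
    using eventually_time[of \<beta>] eventually_large[of \<beta>]
  proof eventually_elim
    case (elim n)
    then have pos: "0 < sqrt (r n)" by simp
    then have eq: "(real (time \<beta> n - gap n) * p n - r n) / sqrt (r n) - \<beta> =
        ((p n * real (time \<beta> n) - (r n + \<beta> * sqrt (r n))) - p n * real (gap n)) / sqrt (r n)"
      using elim by (simp add: of_nat_diff field_simps)
    have "\<bar>(p n * real (time \<beta> n) - (r n + \<beta> * sqrt (r n))) - p n * real (gap n)\<bar> \<le> 2 + sqrt (sqrt (r n))"
      using elim by linarith
    then show ?case unfolding eq using pos by (simp add: abs_divide divide_right_mono)
  qed
qed

lemma m_low_fluctuation: "(\<lambda>n. (real (m_low n) - r n) / sqrt (r n)) \<longlonglongrightarrow> 0"
proof (rule tendsto_of_abs_diff_le)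
  show "(\<lambda>n. (1 + sqrt (sqrt (r n))) / sqrt (r n)) \<longlonglongrightarrow> 0" by (rule r_compose) real_asymp
  show "\<forall>\<^sub>F n in sequentially. \<bar>(real (m_low n) - r n) / sqrt (r n) - 0\<bar> \<le> (1 + sqrt (sqrt (r n))) / sqrt (r n)"
    using eventually_large[of 0]
  proof eventually_elim
    case (elim n)
    then have "real (m_low n) = of_int \<lfloor>r n - sqrt (sqrt (r n))\<rfloor>" by (simp add: m_low_def)
    then have "\<bar>real (m_low n) - r n\<bar> \<le> 1 + sqrt (sqrt (r n))" using elim by linarith
    then show ?case using elim by (simp add: abs_divide divide_right_mono)
  qed
qed

lemma m_high_fluctuation: "(\<lambda>n. (real (m_high n) - r n) / sqrt (r n)) \<longlonglongrightarrow> 0"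
proof (rule tendsto_of_abs_diff_le)
  show "(\<lambda>n. 1 / sqrt (r n)) \<longlonglongrightarrow> 0" by (rule r_compose) real_asymp
  show "\<forall>\<^sub>F n in sequentially. \<bar>(real (m_high n) - r n) / sqrt (r n) - 0\<bar> \<le> 1 / sqrt (r n)"
    using eventually_large[of 0]
  proof eventually_elim
    case (elim n)
    then have "real (m_high n) = of_int \<lceil>r n\<rceil>" by (simp add: m_high_def)
    then have "\<bar>real (m_high n) - r n\<bar> \<le> 1" using elim by linarith
    then show ?case using elim by (simp add: abs_divide divide_right_mono)
  qed
qed

lemma k_powr_r: "2 \<le> n \<Longrightarrow> real (k n) powr r n = real n"
  using ln_pos[of n] k_bounds[of n] by (simp add: powr_def r_def)

lemma k_power_m_high: "2 \<le> n \<Longrightarrow> real n \<le> real (k n) ^ m_high n"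
proof -
  assume n: "2 \<le> n"
  have "real (k n) powr r n \<le> real (k n) powr real (m_high n)"
    using k_bounds[OF n] by (intro powr_mono) (auto simp: m_high_def real_nat_ceiling_ge)
  then show ?thesis using n k_bounds[OF n] by (simp add: k_powr_r powr_realpow)
qed

lemma k_power_m_low: "(\<lambda>n. real (k n) ^ m_low n / real n) \<longlonglongrightarrow> 0"
proof (rule tendsto_of_abs_diff_le)
  show "(\<lambda>n. exp (- (ln 2 * sqrt (sqrt (r n))))) \<longlonglongrightarrow> 0" by (rule r_compose) real_asymp
  show "\<forall>\<^sub>F n in sequentially. \<bar>real (k n) ^ m_low n / real n - 0\<bar> \<le> exp (- (ln 2 * sqrt (sqrt (r n))))"
    using eventually_large[of 0]
  proof eventually_elim
    case (elim n)
    then have n: "2 \<le> n" by simp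
    have "real (k n) ^ m_low n = real (k n) powr real (m_low n)"
      using k_bounds[OF n] by (simp add: powr_realpow)
    also have "\<dots> \<le> real (k n) powr (r n - sqrt (sqrt (r n)))"
      using k_bounds[OF n] elim by (intro powr_mono) (auto simp: m_low_def)
    also have "\<dots> = real n / real (k n) powr sqrt (sqrt (r n))"
      using k_powr_r[OF n] by (simp add: powr_diff)
    finally have "real (k n) ^ m_low n / real n \<le> 1 / real (k n) powr sqrt (sqrt (r n))"
      using n by (simp add: field_simps)
    also have "\<dots> = exp (- (ln (real (k n)) * sqrt (sqrt (r n))))"
      using k_bounds[OF n] by (simp add: powr_def exp_minus field_simps)
    also have "\<dots> \<le> exp (- (ln 2 * sqrt (sqrt (r n))))"
      using ln_pos[OF n] elim by (simp add: mult_right_mono)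
    finally show ?case by simp
  qed
qed

text \<open>These tails enter the mean of the low mass, its second moment and the upper bound on the
  distance. Their common limit is what makes the bounds meet.\<close>

lemma binlt_limits:
  "(\<lambda>n. binlt (time \<beta> n) (p n) (m_low n)) \<longlonglongrightarrow> \<Phi> (- \<beta>)"
  "(\<lambda>n. binlt (time \<beta> n - gap n) (p n) (m_low n)) \<longlonglongrightarrow> \<Phi> (- \<beta>)"
  "(\<lambda>n. binlt (time \<beta> n - gap n) (p n) (m_high n)) \<longlonglongrightarrow> \<Phi> (- \<beta>)"
  using p_mem p_tendsto_0 r_at_top time_fluctuation time_minus_gap_fluctuation m_low_fluctuation m_high_fluctuation
  by (auto intro!: binlt_tendsto)

text \<open>The exponential in \<open>r powr (1/4)\<close> beats the growth of the expected number
  of hits, which is of order \<open>r\<close>. As \<open>r\<close> is at most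
  \<open>ln n / ln 2\<close>, coincidences at the equilibrium rate \<open>1 / n\<close> stay
  negligible over the whole run.\<close>

lemma exp_gap: "(\<lambda>n. exp (- (p n * real (gap n)) / 2) * (1 + real (time \<beta> n - gap n) * p n)) \<longlonglongrightarrow> 0"
  and exp_gap': "(\<lambda>n. exp (- (p n * real (gap n)) / 2)) \<longlonglongrightarrow> 0"
  and time_over_n: "(\<lambda>n. p n * real (time \<beta> n - gap n) / real n) \<longlonglongrightarrow> 0"
proof -
  have bounds: "\<forall>\<^sub>F n in sequentially. exp (- (p n * real (gap n)) / 2) \<le> exp (- (sqrt (sqrt (r n)) - 1) / 2) \<and>
      0 \<le> p n * real (time \<beta> n - gap n) \<and> p n * real (time \<beta> n - gap n) \<le> r n + \<beta> * sqrt (r n) + 1"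
    using eventually_time[of \<beta>] eventually_large[of \<beta>]
  proof eventually_elim
    case (elim n)
    then have n: "2 \<le> n" by simp
    have "p n * real (time \<beta> n - gap n) \<le> p n * real (time \<beta> n)"
      using p_bounds[OF n] by (intro mult_left_mono) auto
    then have "p n * real (time \<beta> n - gap n) \<le> r n + \<beta> * sqrt (r n) + 1" using elim by linarith
    moreover have "0 \<le> p n * real (time \<beta> n - gap n)" using p_bounds[OF n] by simp
    moreover have "exp (- (p n * real (gap n)) / 2) \<le> exp (- (sqrt (sqrt (r n)) - 1) / 2)"
    proof -
      have "sqrt (sqrt (r n)) - 1 \<le> p n * real (gap n)" using elim by linarith
      then show ?thesis by simp
    qed
    ultimately show ?case by blast
  qed
  show "(\<lambda>n. exp (- (p n * real (gap n)) / 2)) \<longlonglongrightarrow> 0"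
  proof (rule tendsto_of_abs_diff_le)
    show "(\<lambda>n. exp (- (sqrt (sqrt (r n)) - 1) / 2)) \<longlonglongrightarrow> 0" by (rule r_compose) real_asymp
    show "\<forall>\<^sub>F n in sequentially. \<bar>exp (- (p n * real (gap n)) / 2) - 0\<bar> \<le> exp (- (sqrt (sqrt (r n)) - 1) / 2)"
      using bounds by eventually_elim simp
  qed
  show "(\<lambda>n. exp (- (p n * real (gap n)) / 2) * (1 + real (time \<beta> n - gap n) * p n)) \<longlonglongrightarrow> 0"
  proof (rule tendsto_of_abs_diff_le)
    show "(\<lambda>n. exp (- (sqrt (sqrt (r n)) - 1) / 2) * (1 + (r n + \<beta> * sqrt (r n) + 1))) \<longlonglongrightarrow> 0"
      by (rule r_compose) real_asymp
    show "\<forall>\<^sub>F n in sequentially. \<bar>exp (- (p n * real (gap n)) / 2) * (1 + real (time \<beta> n - gap n) * p n) - 0\<bar> \<le>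
        exp (- (sqrt (sqrt (r n)) - 1) / 2) * (1 + (r n + \<beta> * sqrt (r n) + 1))"
      using bounds
    proof eventually_elim
      case (elim n)
      have "exp (- (p n * real (gap n)) / 2) * (1 + p n * real (time \<beta> n - gap n)) \<le>
        exp (- (sqrt (sqrt (r n)) - 1) / 2) * (1 + (r n + \<beta> * sqrt (r n) + 1))"
        using elim by (intro mult_mono) auto
      moreover have "0 \<le> exp (- (p n * real (gap n)) / 2) * (1 + p n * real (time \<beta> n - gap n))"
        using elim by (intro mult_nonneg_nonneg) auto
      ultimately show ?case by (simp only: mult.commute[of _ "p n"] diff_zero abs_of_nonneg)
    qed
  qed
  show "(\<lambda>n. p n * real (time \<beta> n - gap n) / real n) \<longlonglongrightarrow> 0"
  proof (rule tendsto_of_abs_diff_le)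
    show "(\<lambda>n. (2 + \<bar>\<beta>\<bar>) * (r n / real n)) \<longlonglongrightarrow> 0" using tendsto_mult[OF tendsto_const r_over_n] by simp
    show "\<forall>\<^sub>F n in sequentially. \<bar>p n * real (time \<beta> n - gap n) / real n - 0\<bar> \<le> (2 + \<bar>\<beta>\<bar>) * (r n / real n)"
      using bounds eventually_large[of \<beta>]
    proof eventually_elim
      case (elim n)
      have "sqrt (r n) \<le> r n" using elim by (intro real_le_lsqrt) (auto simp: power2_eq_square)
      then have "\<beta> * sqrt (r n) \<le> \<bar>\<beta>\<bar> * r n" using elim by (intro mult_mono) auto
      then have "p n * real (time \<beta> n - gap n) \<le> (2 + \<bar>\<beta>\<bar>) * r n"
        using elim unfolding distrib_right by linarith
      then show ?case using elim by (simp add: abs_divide divide_right_mono)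
    qed
  qed
qed

section \<open>Convergence in mean, in probability and of the mixing times\<close>

lemma L1_convergence:
  "(\<lambda>n. integral\<^sup>L (M n) (\<lambda>\<omega>. \<bar>d_TV n (A n) (x0 n) (time \<beta> n) \<omega> - \<Phi> (- \<beta>)\<bar>)) \<longlonglongrightarrow> 0"
proof (rule tendsto_of_abs_diff_le)
  let ?u = "\<lambda>n. time \<beta> n - gap n"
  \<comment> \<open>All tails have the same limit, so the two outside the root cancel and the
    radicand tends to 0.\<close>
  have "(\<lambda>n. binlt (?u n) (p n) (m_high n)
      + 1 / 2 * sqrt (exp (- (p n * real (gap n)) / 2) * (1 + real (?u n) * p n))
      - binlt (time \<beta> n) (p n) (m_low n) + 2 * (real (k n) ^ m_low n / real n) +
    sqrt ((binlt (?u n) (p n) (m_low n))\<^sup>2 + (p n * real (?u n) / real n + 2 * exp (- (p n * real (gap n)) / 2))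
      - 2 * \<Phi> (- \<beta>) * binlt (time \<beta> n) (p n) (m_low n) + (\<Phi> (- \<beta>))\<^sup>2)) \<longlonglongrightarrow>
    \<Phi> (- \<beta>) + 1 / 2 * sqrt 0 - \<Phi> (- \<beta>) + 2 * 0 +
      sqrt ((\<Phi> (- \<beta>))\<^sup>2 + (0 + 2 * 0) - 2 * \<Phi> (- \<beta>) * \<Phi> (- \<beta>) + (\<Phi> (- \<beta>))\<^sup>2)"
    by (intro tendsto_add tendsto_diff tendsto_mult tendsto_const tendsto_real_sqrt tendsto_power
        binlt_limits exp_gap exp_gap' time_over_n k_power_m_low)
  then show "(\<lambda>n. binlt (?u n) (p n) (m_high n)
      + 1 / 2 * sqrt (exp (- (p n * real (gap n)) / 2) * (1 + real (?u n) * p n))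
      - binlt (time \<beta> n) (p n) (m_low n) + 2 * (real (k n) ^ m_low n / real n) +
    sqrt ((binlt (?u n) (p n) (m_low n))\<^sup>2 + (p n * real (?u n) / real n + 2 * exp (- (p n * real (gap n)) / 2))
      - 2 * \<Phi> (- \<beta>) * binlt (time \<beta> n) (p n) (m_low n) + (\<Phi> (- \<beta>))\<^sup>2)) \<longlonglongrightarrow> 0"
    by (simp add: power2_eq_square)
  show "\<forall>\<^sub>F n in sequentially. \<bar>integral\<^sup>L (M n) (\<lambda>\<omega>. \<bar>d_TV n (A n) (x0 n) (time \<beta> n) \<omega> - \<Phi> (- \<beta>)\<bar>) - 0\<bar> \<le>
    binlt (?u n) (p n) (m_high n)
      + 1 / 2 * sqrt (exp (- (p n * real (gap n)) / 2) * (1 + real (?u n) * p n))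
      - binlt (time \<beta> n) (p n) (m_low n) + 2 * (real (k n) ^ m_low n / real n) +
    sqrt ((binlt (?u n) (p n) (m_low n))\<^sup>2 + (p n * real (?u n) / real n + 2 * exp (- (p n * real (gap n)) / 2))
      - 2 * \<Phi> (- \<beta>) * binlt (time \<beta> n) (p n) (m_low n) + (\<Phi> (- \<beta>))\<^sup>2)"
    using eventually_time[of \<beta>] eventually_ge_at_top[of 2]
  proof eventually_elim
    case (elim n)
    have split: "gap n + ?u n = time \<beta> n" using elim by simp
    have "0 \<le> integral\<^sup>L (M n) (\<lambda>\<omega>. \<bar>d_TV n (A n) (x0 n) (time \<beta> n) \<omega> - \<Phi> (- \<beta>)\<bar>)" by simp
    then show ?case
      using block_average.expectation_abs_d_TV_le[OF avg k_power_m_high, of n "gap n" "?u n" "\<Phi> (- \<beta>)" "m_low n"] elim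
      unfolding split by (simp only: hit_eq abs_of_nonneg diff_zero)
  qed
qed

lemma converges_in_prob:
  "tendsto_in_prob M (\<lambda>n. d_TV n (A n) (x0 n) (time \<beta> n)) (\<Phi> (- \<beta>))"
  unfolding tendsto_in_prob_def
proof (intro allI impI)
  fix \<delta> :: real assume \<delta>: "0 < \<delta>"
  show "(\<lambda>n. measure (M n) {\<omega> \<in> space (M n). \<bar>d_TV n (A n) (x0 n) (time \<beta> n) \<omega> - \<Phi> (- \<beta>)\<bar> > \<delta>}) \<longlonglongrightarrow> 0"
  proof (rule tendsto_of_abs_diff_le)
    show "(\<lambda>n. integral\<^sup>L (M n) (\<lambda>\<omega>. \<bar>d_TV n (A n) (x0 n) (time \<beta> n) \<omega> - \<Phi> (- \<beta>)\<bar>) / \<delta>) \<longlonglongrightarrow> 0"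
      using tendsto_divide[OF L1_convergence tendsto_const[of \<delta>]] \<delta> by simp
    show "\<forall>\<^sub>F n in sequentially. \<bar>measure (M n) {\<omega> \<in> space (M n). \<bar>d_TV n (A n) (x0 n) (time \<beta> n) \<omega> - \<Phi> (- \<beta>)\<bar> > \<delta>} - 0\<bar> \<le>
        integral\<^sup>L (M n) (\<lambda>\<omega>. \<bar>d_TV n (A n) (x0 n) (time \<beta> n) \<omega> - \<Phi> (- \<beta>)\<bar>) / \<delta>"
      using eventually_ge_at_top[of 2]
    proof eventually_elim
      case (elim n)
      then interpret block_average "M n" n "k n" "A n" "x0 n" by (rule avg)
      let ?X = "\<lambda>\<omega>. \<bar>d_TV n (A n) (x0 n) (time \<beta> n) \<omega> - \<Phi> (- \<beta>)\<bar>"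
      have int: "integrable (M n) ?X" using integrable_d_TV by simp
      have "prob {\<omega> \<in> space (M n). ?X \<omega> > \<delta>} \<le> prob {\<omega> \<in> space (M n). ?X \<omega> \<ge> \<delta>}"
        using borel_measurable_integrable[OF int] by (intro finite_measure_mono) auto
      also have "\<dots> \<le> expectation ?X / \<delta>"
        using \<delta> by (intro integral_Markov_inequality_measure[where A = "{}"] int) auto
      finally show ?case by simp
    qed
  qed
qed

lemma expectation_limit: "(\<lambda>n. integral\<^sup>L (M n) (d_TV n (A n) (x0 n) (time \<beta> n))) \<longlonglongrightarrow> \<Phi> (- \<beta>)"
proof (rule tendsto_of_abs_diff_le[OF _ L1_convergence])
  show "\<forall>\<^sub>F n in sequentially. \<bar>integral\<^sup>L (M n) (d_TV n (A n) (x0 n) (time \<beta> n)) - \<Phi> (- \<beta>)\<bar> \<le>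
      integral\<^sup>L (M n) (\<lambda>\<omega>. \<bar>d_TV n (A n) (x0 n) (time \<beta> n) \<omega> - \<Phi> (- \<beta>)\<bar>)"
    using eventually_ge_at_top[of 2]
  proof eventually_elim
    case (elim n)
    then interpret block_average "M n" n "k n" "A n" "x0 n" by (rule avg)
    have "expectation (d_TV n (A n) (x0 n) (time \<beta> n)) - \<Phi> (- \<beta>) =
        expectation (\<lambda>\<omega>. d_TV n (A n) (x0 n) (time \<beta> n) \<omega> - \<Phi> (- \<beta>))"
      using integrable_d_TV by (simp add: prob_space)
    then show ?case by (simp add: integral_abs_bound)
  qed
qed

text \<open>The ratio \<open>t_w / t_ent = 1 / sqrt r\<close> vanishes, so the times for different
  \<open>\<beta>\<close> agree to first order.\<close>

lemma time_ratio: "(\<lambda>n. real (time \<beta> n) / t_ent n (k n)) \<longlonglongrightarrow> 1"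
proof -
  have "(\<lambda>n. 1 + (real (time \<beta> n) * p n - r n) / sqrt (r n) * (1 / sqrt (r n))) \<longlonglongrightarrow> 1 + \<beta> * 0"
  proof (intro tendsto_add tendsto_mult tendsto_const time_fluctuation)
    show "(\<lambda>n. 1 / sqrt (r n)) \<longlonglongrightarrow> 0" by (rule r_compose) real_asymp
  qed
  moreover have "\<forall>\<^sub>F n in sequentially. 1 + (real (time \<beta> n) * p n - r n) / sqrt (r n) * (1 / sqrt (r n)) =
      real (time \<beta> n) / t_ent n (k n)"
    using eventually_large[of \<beta>]
  proof eventually_elim
    case (elim n)
    then have "0 < r n" by simp
    then show ?case using elim p_bounds[of n] by (simp add: t_ent_eq field_simps)
  qed
  ultimately show ?thesis by (simp add: Lim_transform_eventually)
qed

text \<open>Two parameters are chosen whose Gaussian limits lie on either side of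
  \<open>\<epsilon>\<close>. Monotonicity of the mean distance then traps the mixing time between
  two times that are both asymptotic to \<open>t_ent\<close>.\<close>

lemma mixing_time_ratio:
  assumes \<epsilon>: "0 < \<epsilon>" "\<epsilon> < 1"
  shows "(\<lambda>n. t_mix (M n) n (A n) (x0 n) \<epsilon> / ereal (t_ent n (k n))) \<longlonglongrightarrow> 1"
proof -
  obtain \<beta> where \<beta>: "\<epsilon> < \<Phi> (- \<beta>)"
  proof -
    have "\<forall>\<^sub>F x in at_top. \<epsilon> < \<Phi> x" using order_tendstoD(1)[OF std_normal.cdf_lim_at_top_prob \<epsilon>(2)] .
    then obtain x where "\<epsilon> < \<Phi> x" by (auto simp: eventually_at_top_linorder)
    then show ?thesis using that[of "- x"] by simp
  qed
  obtain \<beta>' where \<beta>': "\<Phi> (- \<beta>') < \<epsilon>"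
  proof -
    have "\<forall>\<^sub>F x in at_bot. \<Phi> x < \<epsilon>" using order_tendstoD(2)[OF std_normal.cdf_lim_at_bot \<epsilon>(1)] .
    then obtain x where "\<Phi> x < \<epsilon>" by (auto simp: eventually_at_bot_linorder)
    then show ?thesis using that[of "- x"] by simp
  qed
  have pos: "\<forall>\<^sub>F n in sequentially. 0 < t_ent n (k n)"
    using eventually_large[of 0]
    by eventually_elim (auto simp: t_ent_eq intro!: divide_pos_pos p_bounds)
  show ?thesis
  proof (rule tendsto_sandwich)
    show "(\<lambda>n. ereal (real (time \<beta> n) / t_ent n (k n))) \<longlonglongrightarrow> 1"
      "(\<lambda>n. ereal (real (time \<beta>' n) / t_ent n (k n))) \<longlonglongrightarrow> 1"
      using time_ratio by (simp_all add: one_ereal_def)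
    show "\<forall>\<^sub>F n in sequentially. ereal (real (time \<beta> n) / t_ent n (k n)) \<le>
        t_mix (M n) n (A n) (x0 n) \<epsilon> / ereal (t_ent n (k n))"
      using pos order_tendstoD(1)[OF expectation_limit \<beta>] eventually_ge_at_top[of 2]
    proof eventually_elim
      case (elim n)
      then interpret block_average "M n" n "k n" "A n" "x0 n" by (intro avg)
      have "ereal (real (time \<beta> n)) \<le> t_mix (M n) n (A n) (x0 n) \<epsilon>"
        unfolding t_mix_def
      proof (rule INF_greatest)
        fix t assume "t \<in> {t. expectation (d_TV n (A n) (x0 n) t) < \<epsilon>}"
        then have "\<not> t \<le> time \<beta> n" using elim(2) expectation_d_TV_antimono[of t "time \<beta> n"] by auto
        then show "ereal (real (time \<beta> n)) \<le> ereal (real t)" by simp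
      qed
      from ereal_divide_right_mono[OF this, of "ereal (t_ent n (k n))"] elim(1)
      show ?case by simp
    qed
    show "\<forall>\<^sub>F n in sequentially. t_mix (M n) n (A n) (x0 n) \<epsilon> / ereal (t_ent n (k n)) \<le>
        ereal (real (time \<beta>' n) / t_ent n (k n))"
      using pos order_tendstoD(2)[OF expectation_limit \<beta>']
    proof eventually_elim
      case (elim n)
      have "t_mix (M n) n (A n) (x0 n) \<epsilon> \<le> ereal (real (time \<beta>' n))"
        unfolding t_mix_def using elim(2) by (intro INF_lower) simp
      from ereal_divide_right_mono[OF this, of "ereal (t_ent n (k n))"] elim(1)
      show ?case by simp
    qed
  qed
qed

end

theorem corollary2p12:
  fixes k x0 :: "nat \<Rightarrow> nat"
    and M :: "nat \<Rightarrow> 'w measure"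
    and A :: "nat \<Rightarrow> nat \<Rightarrow> 'w \<Rightarrow> nat set"
  assumes k: "\<And>n. 2 \<le> n \<Longrightarrow> k n \<in> {2..n}"
    and x0: "\<And>n. 2 \<le> n \<Longrightarrow> x0 n \<in> {1..n}"
    and A: "\<And>n. 2 \<le> n \<Longrightarrow> block_choices (M n) n (k n) (A n)"
  shows "((\<lambda>n. ln (real (k n)) / ln (real n)) \<longlonglongrightarrow> 0) \<longleftrightarrow>
    (\<forall>\<epsilon>. 0 < \<epsilon> \<and> \<epsilon> < 1 \<longrightarrow>
        (\<lambda>n. t_mix (M n) n (A n) (x0 n) \<epsilon> / ereal (t_ent n (k n))) \<longlonglongrightarrow> 1) \<and>
    (\<forall>\<beta>::real. tendsto_in_prob M
        (\<lambda>n. d_TV n (A n) (x0 n) (nat \<lfloor>t_ent n (k n) + \<beta> * t_w n (k n)\<rfloor>))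
        (cdf std_normal_distribution (- \<beta>)))"
    (is "?small \<longleftrightarrow> ?cutoff \<and> ?profile")
proof -
  have avg: "block_average (M n) n (k n) (A n) (x0 n)" if "2 \<le> n" for n
    using k[OF that] x0[OF that] A[OF that]
    by (auto simp: block_average_def block_size_def block_average_axioms_def)
  show ?thesis
  proof
    assume ?small
    then interpret block_average_seq k x0 M A
      using avg by (intro block_average_seq.intro)
    show "?cutoff \<and> ?profile" using mixing_time_ratio converges_in_prob by blast
  next
    assume "?cutoff \<and> ?profile"
    then have profile: ?profile by blast
    show ?small
    proof (rule ccontr)
      assume "\<not> ?small"
      \<comment> \<open>Failure of the limit yields only infinitely many bad indices, hence a
        frequently statement, to be combined with properties that hold eventually.\<close>
      then obtain c where c: "0 < c" and
        freq: "\<exists>\<^sub>F n in sequentially. \<not> norm (ln (real (k n)) / ln (real n)) < c"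
        unfolding tendsto_iff by (auto simp: frequently_def dist_norm)
      \<comment> \<open>At this \<open>\<beta>\<close> the time \<open>t_ent + \<beta> t_w\<close> is at most 0 whenever \<open>ln k / ln n \<ge> c\<close>, so that the
        process has not moved, although \<open>\<Phi> (- \<beta>) < 1\<close>.\<close>
      define \<beta> where "\<beta> = - (1 / sqrt c)"
      \<comment> \<open>Half of the gap between the claimed limit and 1. Once
        \<open>1 / n < \<delta>\<close>, the initial distance \<open>1 - 1 / n\<close> misses the
        limit by more than \<open>\<delta>\<close>.\<close>
      define \<delta> where "\<delta> = (1 - \<Phi> (- \<beta>)) / 2"
      have \<delta>: "0 < \<delta>" using \<Phi>_less_1[of "- \<beta>"] by (simp add: \<delta>_def)
      have "(\<lambda>n. measure (M n) {\<omega> \<in> space (M n).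
          \<bar>d_TV n (A n) (x0 n) (nat \<lfloor>t_ent n (k n) + \<beta> * t_w n (k n)\<rfloor>) \<omega> - \<Phi> (- \<beta>)\<bar> > \<delta>}) \<longlonglongrightarrow> 0"
        using profile \<delta> unfolding tendsto_in_prob_def by blast
      then have small: "\<forall>\<^sub>F n in sequentially. measure (M n) {\<omega> \<in> space (M n).
          \<bar>d_TV n (A n) (x0 n) (nat \<lfloor>t_ent n (k n) + \<beta> * t_w n (k n)\<rfloor>) \<omega> - \<Phi> (- \<beta>)\<bar> > \<delta>} < 1"
        by (rule order_tendstoD) simp
      have "(\<lambda>n. 1 / real n) \<longlonglongrightarrow> 0" by real_asymp
      then have "\<forall>\<^sub>F n in sequentially. 1 / real n < \<delta>" using \<delta> by (rule order_tendstoD)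
      from frequently_eventually_frequently[OF freq eventually_conj[OF small eventually_conj[OF this eventually_ge_at_top[of 2]]]]
      have "\<exists>\<^sub>F n in sequentially. False"
      proof (rule frequently_elim1, elim conjE)
        fix n
        assume n: "2 \<le> n" "1 / real n < \<delta>" and large: "\<not> norm (ln (real (k n)) / ln (real n)) < c"
          and small: "measure (M n) {\<omega> \<in> space (M n).
          \<bar>d_TV n (A n) (x0 n) (nat \<lfloor>t_ent n (k n) + \<beta> * t_w n (k n)\<rfloor>) \<omega> - \<Phi> (- \<beta>)\<bar> > \<delta>} < 1"
        interpret block_average "M n" n "k n" "A n" "x0 n" by (rule avg[OF n(1)])
        define R where "R = ln (real n) / ln (real (k n))"
        have lnpos: "0 < ln (real n)" "0 < ln (real (k n))" using k[OF n(1)] n(1) by auto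
        then have R: "0 < R" "R \<le> 1 / c"
          using large c by (auto simp: R_def field_simps)
        have "sqrt R \<le> 1 / sqrt c" using R(2) by (metis real_sqrt_divide real_sqrt_le_mono real_sqrt_one)
        \<comment> \<open>The left side is \<open>sqrt R\<close> times
          \<open>sqrt R - 1 / sqrt c\<close>, and the second factor is not positive.\<close>
        then have le: "R + \<beta> * sqrt R \<le> 0"
          using R(1) mult_right_mono[of "sqrt R" "1 / sqrt c" "sqrt R"] by (simp add: \<beta>_def)
        have eq: "t_ent n (k n) + \<beta> * t_w n (k n) = real n / real (k n) * (R + \<beta> * sqrt R)"
          by (simp add: t_ent_def t_w_def R_def real_sqrt_divide distrib_left mult_ac)
        have "t_ent n (k n) + \<beta> * t_w n (k n) \<le> 0"
          unfolding eq by (rule mult_nonneg_nonpos[OF _ le]) simp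
        then have time0: "nat \<lfloor>t_ent n (k n) + \<beta> * t_w n (k n)\<rfloor> = 0" by (simp add: floor_le_iff)
        have "1 - \<Phi> (- \<beta>) = 2 * \<delta>" by (simp add: \<delta>_def)
        then have "\<bar>1 - 1 / real n - \<Phi> (- \<beta>)\<bar> > \<delta>" using n(2) by linarith
        \<comment> \<open>At time 0 the distance is deterministic, so the event is the whole
          space.\<close>
        then have "prob {\<omega> \<in> space (M n).
          \<bar>d_TV n (A n) (x0 n) (nat \<lfloor>t_ent n (k n) + \<beta> * t_w n (k n)\<rfloor>) \<omega> - \<Phi> (- \<beta>)\<bar> > \<delta>} = 1"
          unfolding time0 d_TV_0 by (simp add: prob_space)
        then show False using small by simp
      qed
      then show False by simp
    qed
  qed
qed

end
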